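(* Let $G$ and $H$ be finite nontrivial groups, and let $d_{\min}$ denote the smallest dimension of a nontrivial irreducible complex representation of $G$. Let $\epsilon \ge 0$ and let $f : G \to H$ be a function such that $$\sum_{y \in H} \left| p_f(y) - \frac{1}{|H|} \right|^2 \le \frac{\epsilon}{|H|},$$ where $p_f(y) = \Pr_x[f(x) = y]$ for $x$ uniformly random in $G$. Then, for $x,y \in G$ independent and uniformly random, $$\Pr[f(xy) = f(x)\,f(y)] \;\le\; \frac12 \min_{\sigma \neq 1} \left( 1 + \sqrt{\frac{\epsilon}{d_\sigma}} + \sqrt{\frac{d_\sigma}{d_{\min}}} \right),$$ where $\sigma$ ranges over all nontrivial irreducible complex representations of $H$ and $d_\sigma$ denotes the dimension of $\sigma$.
   Context: The function $f$ is arbitrary; it is not assumed to be a homomorphism. The trivial representation (denoted $1$) is the one-dimensional representation sending every group element to $1$. *)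

theory Defs
  imports
    "HOL-Algebra.Group"
    "HOL-Probability.Probability_Mass_Function"
    "Jordan_Normal_Form.VS_Connect"
begin

definition GL :: "nat \<Rightarrow> complex mat monoid" where
  "GL n = units_of (ring_mat TYPE(complex) n ())"

text \<open>Complex representations are taken in matrix form, on the space of column vectors of
  length \<open>n\<close>; up to isomorphism this covers all finite-dimensional complex representations.
  The values of \<open>\<rho>\<close> outside \<open>carrier G\<close> are irrelevant.\<close>

definition complex_rep :: "('a, 'b) monoid_scheme \<Rightarrow> nat \<Rightarrow> ('a \<Rightarrow> complex mat) \<Rightarrow> bool" where
  "complex_rep G n \<rho> \<longleftrightarrow> \<rho> \<in> hom G (GL n)"

definition irreducible_rep :: "('a, 'b) monoid_scheme \<Rightarrow> nat \<Rightarrow> ('a \<Rightarrow> complex mat) \<Rightarrow> bool" where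
  "irreducible_rep G n \<rho> \<longleftrightarrow>
     complex_rep G n \<rho> \<and> n > 0 \<and>
     (\<forall>W. VectorSpace.subspace class_ring W (module_vec TYPE(complex) n) \<and>
          (\<forall>g\<in>carrier G. \<forall>w\<in>W. \<rho> g *\<^sub>v w \<in> W)
          \<longrightarrow> W = {0\<^sub>v n} \<or> W = carrier_vec n)"

text \<open>A matrix representation isomorphic to the trivial one is equal to it (on \<open>carrier G\<close>),
  so no quotient by isomorphism is needed here.\<close>

definition trivial_rep :: "('a, 'b) monoid_scheme \<Rightarrow> nat \<Rightarrow> ('a \<Rightarrow> complex mat) \<Rightarrow> bool" where
  "trivial_rep G n \<rho> \<longleftrightarrow> n = 1 \<and> (\<forall>g\<in>carrier G. \<rho> g = 1\<^sub>m 1)"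

definition nontrivial_irreps :: "('a, 'b) monoid_scheme \<Rightarrow> (nat \<times> ('a \<Rightarrow> complex mat)) set" where
  "nontrivial_irreps G = {(n, \<rho>). irreducible_rep G n \<rho> \<and> \<not> trivial_rep G n \<rho>}"

definition min_nontrivial_dim :: "('a, 'b) monoid_scheme \<Rightarrow> nat" where
  "min_nontrivial_dim G = (LEAST d. \<exists>\<rho>. (d, \<rho>) \<in> nontrivial_irreps G)"

end

theory Submission
  imports Defs
begin

text \<open>Let \<open>\<sigma>\<close> be a nontrivial irreducible representation of \<open>H\<close> of dimension \<open>d\<close>, taken unitary, and
  put \<open>F = \<sigma> \<circ> f\<close>. The normalised trace of \<open>F x * F y * (F (x y))\<^sup>\<dagger>\<close> is \<open>1\<close> when \<open>f (x y) = f x f y\<close> and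
  has real part at least \<open>-1\<close> otherwise, so its average \<open>E\<close> satisfies \<open>2 P - 1 \<le> E\<close>. Write
  \<open>F = A + F\<^sub>0\<close> with \<open>A\<close> the average of \<open>F\<close>. All mixed terms of \<open>E\<close> vanish. As \<open>\<sigma>\<close> kills the uniform
  distribution, \<open>A\<close> only sees the deviation of \<open>p\<^sub>f\<close> from uniform, and orthogonality of matrix
  coefficients gives it operator norm at most \<open>sqrt (\<epsilon> / d)\<close>. The \<open>F\<^sub>0\<close> part is bounded by
  \<open>sqrt (d / d\<^sub>m\<^sub>i\<^sub>n)\<close> because convolution by a function \<open>u\<close> on \<open>G\<close> has small operator norm on mean-zero
  functions: its top singular space is an invariant subspace, hence has dimension at least
  \<open>d\<^sub>m\<^sub>i\<^sub>n\<close>, while its Hilbert-Schmidt norm is \<open>sqrt \<bar>G\<bar>\<close> times the norm of \<open>u\<close>. The same estimate on an irreducible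
  space of functions on \<open>H\<close> replaces Schur orthogonality.\<close>

unbundle no vec_syntax

section \<open>Hermitian geometry of complex functions on a finite set\<close>

definition ip :: "'a set \<Rightarrow> ('a \<Rightarrow> complex) \<Rightarrow> ('a \<Rightarrow> complex) \<Rightarrow> complex" where
  "ip X u v = (\<Sum>x\<in>X. cnj (u x) * v x)"

definition nsq :: "'a set \<Rightarrow> ('a \<Rightarrow> complex) \<Rightarrow> real" where
  "nsq X u = (\<Sum>x\<in>X. (cmod (u x))\<^sup>2)"

text \<open>Elements vanish outside \<open>X\<close>, so that equality on \<open>X\<close> is
  equality of functions and \<open>nsq X\<close> is definite on \<open>W\<close> when
  \<open>X\<close> is finite.\<close>

definition fun_subspace :: "'a set \<Rightarrow> ('a \<Rightarrow> complex) set \<Rightarrow> bool" where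
  "fun_subspace X W \<longleftrightarrow> (\<lambda>x. 0) \<in> W \<and> (\<forall>u\<in>W. \<forall>v\<in>W. (\<lambda>x. u x + v x) \<in> W) \<and>
     (\<forall>c. \<forall>u\<in>W. (\<lambda>x. c * u x) \<in> W) \<and> (\<forall>u\<in>W. \<forall>x. x \<notin> X \<longrightarrow> u x = 0)"

definition orthonormal :: "'a set \<Rightarrow> (nat \<Rightarrow> 'a \<Rightarrow> complex) \<Rightarrow> nat \<Rightarrow> bool" where
  "orthonormal X b m \<longleftrightarrow> (\<forall>i<m. \<forall>j<m. ip X (b i) (b j) = (if i = j then 1 else 0))"

text \<open>The length \<open>m\<close> stands in for the dimension of \<open>W\<close>. The
  expansion is an equation between functions, so it also covers points outside
  \<open>X\<close>.\<close>

definition onb :: "'a set \<Rightarrow> (nat \<Rightarrow> 'a \<Rightarrow> complex) \<Rightarrow> nat \<Rightarrow> ('a \<Rightarrow> complex) set \<Rightarrow> bool" where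
  "onb X b m W \<longleftrightarrow> orthonormal X b m \<and> (\<forall>i<m. b i \<in> W) \<and>
     (\<forall>w\<in>W. w = (\<lambda>x. \<Sum>i<m. ip X (b i) w * b i x))"

section \<open>Algebra of the inner product and the squared norm\<close>

lemma nsq_nonneg: "nsq X u \<ge> 0"
  by (simp add: nsq_def sum_nonneg)

lemma cnj_mult_self: "cnj z * z = of_real ((cmod z)\<^sup>2)"
  by (metis complex_norm_square mult.commute)

lemma ip_self: "ip X u u = of_real (nsq X u)"
  by (simp add: ip_def nsq_def cnj_mult_self del: of_real_power)

lemma cnj_ip: "cnj (ip X u v) = ip X v u"
  by (simp add: ip_def mult.commute)

lemma of_real_cmod_sq: "of_real ((cmod (ip X u v))\<^sup>2) = ip X u v * ip X v u"
  by (metis cnj_ip complex_norm_square)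

lemma ip_diff: "ip X u (\<lambda>x. v x - w x) = ip X u v - ip X u w"
  by (simp add: ip_def algebra_simps sum_subtractf)

lemma ip_scale: "ip X u (\<lambda>x. c * v x) = c * ip X u v"
  by (simp add: ip_def algebra_simps sum_distrib_left)

lemma ip_sum: "ip X u (\<lambda>x. \<Sum>i\<in>I. c i * v i x) = (\<Sum>i\<in>I. c i * ip X u (v i))"
  unfolding ip_def sum_distrib_left by (subst sum.swap) (simp add: algebra_simps)

lemma nsq_scale: "nsq X (\<lambda>x. c * u x) = (cmod c)\<^sup>2 * nsq X u"
  by (simp add: nsq_def norm_mult power_mult_distrib sum_distrib_left)

lemma nsq_parallelogram:
  "nsq X (\<lambda>x. u x + v x) + nsq X (\<lambda>x. u x - v x) = 2 * nsq X u + 2 * nsq X v"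
proof -
  have "(cmod (a + b))\<^sup>2 + (cmod (a - b))\<^sup>2 = 2 * (cmod a)\<^sup>2 + 2 * (cmod b)\<^sup>2" for a b
    unfolding cmod_power2 by (simp add: power2_eq_square algebra_simps)
  then have "(\<Sum>x\<in>X. (cmod (u x + v x))\<^sup>2 + (cmod (u x - v x))\<^sup>2) =
      (\<Sum>x\<in>X. 2 * (cmod (u x))\<^sup>2 + 2 * (cmod (v x))\<^sup>2)"
    by simp
  then show ?thesis
    unfolding nsq_def sum.distrib by (simp only: sum_distrib_left)
qed

lemma nsq_eq_0: "finite X \<Longrightarrow> nsq X u = 0 \<longleftrightarrow> (\<forall>x\<in>X. u x = 0)"
  by (simp add: nsq_def sum_nonneg_eq_0_iff)

lemma cmod_ip_le: "cmod (ip X u v) \<le> sqrt (nsq X u) * sqrt (nsq X v)"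
proof -
  have "cmod (ip X u v) \<le> (\<Sum>x\<in>X. cmod (u x) * cmod (v x))"
    unfolding ip_def by (rule order_trans[OF norm_sum]) (simp add: norm_mult)
  also have "\<dots> \<le> L2_set (\<lambda>x. cmod (u x)) X * L2_set (\<lambda>x. cmod (v x)) X"
    using L2_set_mult_ineq[of "\<lambda>x. cmod (u x)" "\<lambda>x. cmod (v x)" X] by simp
  finally show ?thesis by (simp add: L2_set_def nsq_def)
qed

section \<open>Orthonormal systems, Bessel's inequality and bases\<close>

lemma orthonormal_residual:
  assumes "orthonormal X b m"
  shows "j < m \<Longrightarrow> ip X (b j) (\<lambda>x. v x - (\<Sum>i<m. ip X (b i) v * b i x)) = 0"
    and "nsq X (\<lambda>x. v x - (\<Sum>i<m. ip X (b i) v * b i x)) =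
           nsq X v - (\<Sum>i<m. (cmod (ip X (b i) v))\<^sup>2)"
proof -
  let ?s = "\<lambda>x. \<Sum>i<m. ip X (b i) v * b i x"
  let ?r = "\<lambda>x. v x - ?s x"
  have r0: "ip X (b j) ?r = 0" if "j < m" for j
  proof -
    have "(\<Sum>i<m. ip X (b i) v * ip X (b j) (b i)) = (\<Sum>i<m. if i = j then ip X (b i) v else 0)"
      using assms that by (intro sum.cong) (auto simp: orthonormal_def)
    then show ?thesis using that by (simp add: ip_diff ip_sum)
  qed
  then show "j < m \<Longrightarrow> ip X (b j) ?r = 0" .
  \<comment> \<open>The residual is orthogonal to its own projection \<open>?s\<close>, so
    \<open>ip X ?r ?r\<close> collapses to \<open>ip X ?r v\<close>.\<close>
  have "ip X ?r (b j) = 0" if "j < m" for j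
    using r0[OF that] cnj_ip[of X "b j" ?r] by simp
  then have "ip X ?r ?s = 0"
    by (simp add: ip_sum)
  then have "ip X ?r ?r = ip X ?r v"
    using ip_diff[of X ?r v ?s] by simp
  also have "\<dots> = cnj (ip X v ?r)"
    by (simp add: cnj_ip)
  also have "\<dots> = cnj (ip X v v - (\<Sum>i<m. ip X (b i) v * ip X v (b i)))"
    by (simp only: ip_diff ip_sum)
  also have "\<dots> = of_real (nsq X v - (\<Sum>i<m. (cmod (ip X (b i) v))\<^sup>2))"
    by (simp add: ip_self cnj_ip of_real_cmod_sq mult.commute del: of_real_power)
  finally have "complex_of_real (nsq X ?r) = of_real (nsq X v - (\<Sum>i<m. (cmod (ip X (b i) v))\<^sup>2))"
    by (simp only: ip_self)
  then show "nsq X ?r = nsq X v - (\<Sum>i<m. (cmod (ip X (b i) v))\<^sup>2)"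
    by (simp only: of_real_eq_iff)
qed

lemma bessel:
  assumes "orthonormal X b m"
  shows "(\<Sum>i<m. (cmod (ip X (b i) v))\<^sup>2) \<le> nsq X v"
  using orthonormal_residual(2)[OF assms, of v]
    nsq_nonneg[of X "\<lambda>x. v x - (\<Sum>i<m. ip X (b i) v * b i x)"] by simp

text \<open>Bessel's inequality for the indicator of a point \<open>x\<close> bounds the sum of
  \<open>(cmod (b i x))^2\<close> over \<open>i\<close> by 1; summing over \<open>x\<close> counts
  the \<open>m\<close> unit vectors.\<close>

lemma orthonormal_card:
  assumes "finite X" "orthonormal X b m"
  shows "m \<le> card X"
proof -
  have one: "(\<Sum>i<m. (cmod (b i x))\<^sup>2) \<le> 1" if "x \<in> X" for x
  proof -
    have "ip X (b i) (\<lambda>y. if y = x then 1 else 0) = cnj (b i x)" for i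
      using that assms(1) by (simp add: ip_def if_distrib[of "\<lambda>z. _ * z"] cong: if_cong)
    moreover have "nsq X (\<lambda>y. if y = x then 1 else 0) = 1"
      using that assms(1) by (simp add: nsq_def if_distrib[of "\<lambda>z. (cmod z)\<^sup>2"] cong: if_cong)
    ultimately show ?thesis
      using bessel[OF assms(2), of "\<lambda>y. if y = x then 1 else 0"] by simp
  qed
  have "nsq X (b i) = 1" if "i < m" for i
    using assms(2) that ip_self[of X "b i"] by (simp add: orthonormal_def)
  then have "real m = (\<Sum>i<m. nsq X (b i))" by simp
  also have "\<dots> = (\<Sum>x\<in>X. \<Sum>i<m. (cmod (b i x))\<^sup>2)"
    unfolding nsq_def by (rule sum.swap)
  also have "\<dots> \<le> (\<Sum>x\<in>X. 1)"
    by (intro sum_mono one)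
  finally show ?thesis by simp
qed

lemma fun_subspace_sum:
  assumes "fun_subspace X W" "finite I" "\<And>i. i \<in> I \<Longrightarrow> v i \<in> W"
  shows "(\<lambda>x. \<Sum>i\<in>I. c i * v i x) \<in> W"
  using assms(2,3)
proof (induction I rule: finite_induct)
  case empty
  then show ?case using assms(1) by (simp add: fun_subspace_def)
next
  case (insert i I)
  have "(\<lambda>x. c i * v i x) \<in> W" "(\<lambda>x. \<Sum>i\<in>I. c i * v i x) \<in> W"
    using assms(1) insert by (auto simp: fun_subspace_def)
  with assms(1) have "(\<lambda>x. c i * v i x + (\<Sum>i\<in>I. c i * v i x)) \<in> W"
    by (simp add: fun_subspace_def)
  then show ?case using insert.hyps by simp
qed

lemma fun_subspace_diff:
  assumes "fun_subspace X W" "u \<in> W" "v \<in> W"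
  shows "(\<lambda>x. u x - v x) \<in> W"
proof -
  have "(\<lambda>x. -1 * v x) \<in> W"
    using assms unfolding fun_subspace_def by blast
  then have "\<forall>u\<in>W. (\<lambda>x. u x + -1 * v x) \<in> W"
    using assms(1) unfolding fun_subspace_def by fast
  with assms(2) show ?thesis by simp
qed

text \<open>One Gram-Schmidt step: the residual of \<open>w\<close> is nonzero, and once normalised
  it becomes the next vector of the system.\<close>

lemma orthonormal_extend:
  assumes X: "finite X" and W: "fun_subspace X W"
    and b: "orthonormal X b m" "\<forall>i<m. b i \<in> W"
    and w: "w \<in> W" and neq: "w \<noteq> (\<lambda>x. \<Sum>i<m. ip X (b i) w * b i x)"
  obtains b' where "orthonormal X b' (Suc m)" "\<forall>i<Suc m. b' i \<in> W"
proof -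
  define r where "r = (\<lambda>x. w x - (\<Sum>i<m. ip X (b i) w * b i x))"
  have rW: "r \<in> W"
    unfolding r_def using b(2) by (intro fun_subspace_diff[OF W w] fun_subspace_sum[OF W]) auto
  obtain x where "r x \<noteq> 0" using neq by (auto simp: r_def fun_eq_iff)
  moreover have "x \<in> X" using W rW \<open>r x \<noteq> 0\<close> by (auto simp: fun_subspace_def)
  ultimately have nz: "nsq X r \<noteq> 0" using X by (auto simp: nsq_eq_0)
  then have pos: "nsq X r > 0" using nsq_nonneg[of X r] by simp
  define c where "c = complex_of_real (1 / sqrt (nsq X r))"
  define b' where "b' = b(m := (\<lambda>x. c * r x))"
  have sr: "ip X (\<lambda>x. c * r x) (\<lambda>x. c * r x) = 1"
  proof -
    have "(cmod c)\<^sup>2 * nsq X r = 1"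
      using pos by (simp add: c_def norm_divide power_divide)
    then show ?thesis by (simp add: ip_self nsq_scale)
  qed
  have b0: "ip X (b j) (\<lambda>x. c * r x) = 0" if "j < m" for j
    using orthonormal_residual(1)[OF b(1) that, of w] by (simp add: ip_scale r_def)
  then have b0': "ip X (\<lambda>x. c * r x) (b j) = 0" if "j < m" for j
    using that cnj_ip[of X "b j" "\<lambda>x. c * r x"] by simp
  show ?thesis
  proof
    show "orthonormal X b' (Suc m)"
      using b(1) sr b0 b0' by (auto simp: orthonormal_def b'_def less_Suc_eq)
    show "\<forall>i<Suc m. b' i \<in> W"
      using b(2) rW W by (auto simp: b'_def less_Suc_eq fun_subspace_def)
  qed
qed

text \<open>By \<open>orthonormal_card\<close> there is a longest orthonormal system in
  \<open>W\<close>; if it failed to expand some \<open>w\<close>, then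
  \<open>orthonormal_extend\<close> would lengthen it.\<close>

lemma exists_onb:
  assumes X: "finite X" and W: "fun_subspace X W"
  obtains b m where "onb X b m W"
proof -
  define P where "P m \<longleftrightarrow> (\<exists>b. orthonormal X b m \<and> (\<forall>i<m. b i \<in> W))" for m
  have "P 0" by (simp add: P_def orthonormal_def)
  moreover have "\<forall>m. P m \<longrightarrow> m \<le> card X"
    using orthonormal_card[OF X] by (auto simp: P_def)
  ultimately have "P (Greatest P)" and great: "\<And>m. P m \<Longrightarrow> m \<le> Greatest P"
    by (blast intro: GreatestI_nat Greatest_le_nat)+
  then obtain b m where b: "orthonormal X b m" "\<forall>i<m. b i \<in> W" and m: "m = Greatest P"
    by (auto simp: P_def)
  have "w = (\<lambda>x. \<Sum>i<m. ip X (b i) w * b i x)" if w: "w \<in> W" for w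
  proof (rule ccontr)
    assume "w \<noteq> (\<lambda>x. \<Sum>i<m. ip X (b i) w * b i x)"
    then have "P (Suc m)"
      using orthonormal_extend[OF X W b w] unfolding P_def by blast
    with great m show False by force
  qed
  with b have "onb X b m W" unfolding onb_def by blast
  then show ?thesis by (rule that)
qed

lemma parseval:
  assumes "onb X b m W" "w \<in> W"
  shows "(\<Sum>i<m. (cmod (ip X (b i) w))\<^sup>2) = nsq X w"
proof -
  have "nsq X (\<lambda>x. w x - (\<Sum>i<m. ip X (b i) w * b i x)) = 0"
  proof -
    have "w x - (\<Sum>i<m. ip X (b i) w * b i x) = 0" for x
    proof -
      have "w = (\<lambda>x. \<Sum>i<m. ip X (b i) w * b i x)"
        using assms unfolding onb_def by blast
      from fun_cong[OF this, of x] show ?thesis by (rule eq_iff_diff_eq_0[THEN iffD1])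
    qed
    then show ?thesis by (simp add: nsq_def)
  qed
  then show ?thesis
    using orthonormal_residual(2)[of X b m w] assms(1) by (simp add: onb_def)
qed

lemma onb_expand:
  assumes "onb X b m W" "w \<in> W"
  shows "w = (\<lambda>x. \<Sum>i<m. ip X (b i) w * b i x)"
  using assms unfolding onb_def by blast

lemma orthonormal_nsq: "orthonormal X b m \<Longrightarrow> i < m \<Longrightarrow> nsq X (b i) = 1"
  using ip_self[of X "b i"] by (simp add: orthonormal_def)

text \<open>Sum the squared moduli of \<open>ip X (b j) (e i)\<close> over all pairs: Parseval
  evaluates the sum as \<open>q\<close>, and Bessel with the roles exchanged bounds it by
  \<open>m\<close>.\<close>

lemma orthonormal_le_onb:
  assumes e: "orthonormal X e q" "\<forall>i<q. e i \<in> W" and b: "onb X b m W"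
  shows "q \<le> m"
proof -
  have ob: "orthonormal X b m" using b by (simp add: onb_def)
  have "real q = (\<Sum>i<q. nsq X (e i))"
    using orthonormal_nsq[OF e(1)] by simp
  also have "\<dots> = (\<Sum>i<q. \<Sum>j<m. (cmod (ip X (b j) (e i)))\<^sup>2)"
    using e(2) by (intro sum.cong refl) (simp add: parseval[OF b])
  also have "\<dots> = (\<Sum>j<m. \<Sum>i<q. (cmod (ip X (e i) (b j)))\<^sup>2)"
    by (subst sum.swap) (simp add: cnj_ip[symmetric, of X "b _"])
  also have "\<dots> \<le> (\<Sum>j<m. nsq X (b j))"
    by (intro sum_mono bessel e(1))
  also have "\<dots> = real m"
    using orthonormal_nsq[OF ob] by simp
  finally show ?thesis by simp
qed

text \<open>A vector of \<open>W\<close> outside \<open>E\<close> would extend \<open>e\<close> to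
  an orthonormal system in \<open>W\<close> of length \<open>p + 1 > m\<close>, against
  \<open>orthonormal_le_onb\<close>.\<close>

lemma onb_subset_eq:
  assumes X: "finite X" and W: "fun_subspace X W" and b: "onb X b m W"
    and E: "E \<subseteq> W" "fun_subspace X E" and e: "onb X e p E" and "m \<le> p"
  shows "E = W"
proof (rule ccontr)
  assume "E \<noteq> W"
  then obtain w where w: "w \<in> W" "w \<notin> E" using E by blast
  have oe: "orthonormal X e p" "\<forall>i<p. e i \<in> E" using e by (auto simp: onb_def)
  then have "(\<lambda>x. \<Sum>i<p. ip X (e i) w * e i x) \<in> E"
    by (intro fun_subspace_sum[OF E(2)]) auto
  with w have "w \<noteq> (\<lambda>x. \<Sum>i<p. ip X (e i) w * e i x)" by metis
  moreover have "\<forall>i<p. e i \<in> W" using oe(2) E by blast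
  ultimately obtain e' where "orthonormal X e' (Suc p)" "\<forall>i<Suc p. e' i \<in> W"
    using orthonormal_extend[OF X W oe(1) _ w(1)] by blast
  from orthonormal_le_onb[OF this b] show False using \<open>m \<le> p\<close> by simp
qed

lemma ip_orthonormal_comb:
  assumes "orthonormal X b m" "i < m"
  shows "ip X (b i) (\<lambda>x. \<Sum>j<m. c j * b j x) = c i"
proof -
  have "(\<Sum>j<m. c j * ip X (b i) (b j)) = (\<Sum>j<m. if j = i then c j else 0)"
    using assms by (intro sum.cong) (auto simp: orthonormal_def)
  then show ?thesis using assms by (simp add: ip_sum)
qed

lemma nsq_orthonormal_comb:
  assumes "orthonormal X b m"
  shows "nsq X (\<lambda>x. \<Sum>j<m. c j * b j x) = (\<Sum>j<m. (cmod (c j))\<^sup>2)"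
proof -
  let ?s = "\<lambda>x. \<Sum>j<m. c j * b j x"
  have "nsq X (\<lambda>x. ?s x - (\<Sum>i<m. ip X (b i) ?s * b i x)) = 0"
    by (simp add: ip_orthonormal_comb[OF assms] nsq_def)
  then show ?thesis
    using orthonormal_residual(2)[OF assms, of ?s] by (simp add: ip_orthonormal_comb[OF assms])
qed

section \<open>Convolution on a finite group\<close>

text \<open>Coefficient vectors are total functions on \<open>nat\<close> whose entries from
  \<open>n\<close> on are pinned to 0; the sphere is then a closed part of a product of compact
  sets. It supplies the maximiser in \<open>conv_max_on_subspace\<close>.\<close>

lemma compact_coeff_sphere:
  "compact {c :: nat \<Rightarrow> complex. (\<forall>i\<ge>n. c i = 0) \<and> (\<Sum>i<n. (cmod (c i))\<^sup>2) = 1}"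
proof -
  let ?B = "\<lambda>i. if i < n then cball 0 1 else {0 :: complex}"
  let ?S = "{c :: nat \<Rightarrow> complex. (\<Sum>i<n. (cmod (c i))\<^sup>2) = 1}"
  have "compactin (product_topology (\<lambda>i. euclidean) UNIV) (PiE UNIV ?B)"
    by (subst compactin_PiE) auto
  then have comp: "compact (PiE UNIV ?B)"
    by (simp add: euclidean_product_topology)
  have cont: "continuous_on UNIV (\<lambda>c :: nat \<Rightarrow> complex. c i)" for i
    by (rule continuous_on_product_coordinates)
  have "closed ?S"
    by (intro closed_Collect_eq continuous_intros cont)
  have "{c. (\<forall>i\<ge>n. c i = 0) \<and> (\<Sum>i<n. (cmod (c i))\<^sup>2) = 1} = PiE UNIV ?B \<inter> ?S"
  proof (rule equalityI; rule subsetI)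
    fix c :: "nat \<Rightarrow> complex"
    assume c: "c \<in> {c. (\<forall>i\<ge>n. c i = 0) \<and> (\<Sum>i<n. (cmod (c i))\<^sup>2) = 1}"
    have "cmod (c i) \<le> 1" if "i < n" for i
    proof -
      have "(cmod (c i))\<^sup>2 \<le> (\<Sum>i<n. (cmod (c i))\<^sup>2)"
        using that by (intro member_le_sum) auto
      with c have "(cmod (c i))\<^sup>2 \<le> 1\<^sup>2" by simp
      then show ?thesis by (rule power2_le_imp_le) simp
    qed
    with c show "c \<in> PiE UNIV ?B \<inter> ?S" by (auto simp: PiE_def)
  next
    fix c :: "nat \<Rightarrow> complex"
    assume c: "c \<in> PiE UNIV ?B \<inter> ?S"
    then have "c i \<in> ?B i" for i by (blast dest: PiE_mem)
    then have "c i = 0" if "i \<ge> n" for i using that by (metis not_le singletonD)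
    with c show "c \<in> {c. (\<forall>i\<ge>n. c i = 0) \<and> (\<Sum>i<n. (cmod (c i))\<^sup>2) = 1}" by simp
  qed
  with compact_Int_closed[OF comp \<open>closed ?S\<close>] show ?thesis by simp
qed

locale finite_group = group G for G :: "('a, 'c) monoid_scheme" (structure) +
  assumes finite_carrier: "finite (carrier G)"
begin

abbreviation N :: real where "N \<equiv> real (card (carrier G))"

text \<open>Right regular representation: translating on the right makes \<open>trans\<close>
  multiplicative in the order of the group.\<close>

definition trans :: "'a \<Rightarrow> ('a \<Rightarrow> complex) \<Rightarrow> 'a \<Rightarrow> complex" where
  "trans g u = (\<lambda>x. if x \<in> carrier G then u (x \<otimes> g) else 0)"

definition conv :: "('a \<Rightarrow> complex) \<Rightarrow> ('a \<Rightarrow> complex) \<Rightarrow> 'a \<Rightarrow> complex" where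
  "conv k v = (\<lambda>z. if z \<in> carrier G then \<Sum>y\<in>carrier G. k (z \<otimes> inv y) * v y else 0)"

text \<open>Subrepresentation of the right regular representation.\<close>

definition invariant :: "('a \<Rightarrow> complex) set \<Rightarrow> bool" where
  "invariant W \<longleftrightarrow> fun_subspace (carrier G) W \<and> (\<forall>g\<in>carrier G. \<forall>w\<in>W. trans g w \<in> W)"

lemma N_pos: "N > 0"
  using finite_carrier one_closed by (auto simp: card_gt_0_iff)

lemma bij_betw_mult_right: "g \<in> carrier G \<Longrightarrow> bij_betw (\<lambda>x. x \<otimes> g) (carrier G) (carrier G)"
  by (rule bij_betwI[where g = "\<lambda>x. x \<otimes> inv g"]) (auto simp: m_assoc)

lemma bij_betw_mult_left: "g \<in> carrier G \<Longrightarrow> bij_betw (\<lambda>x. g \<otimes> x) (carrier G) (carrier G)"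
  by (rule bij_betwI[where g = "\<lambda>x. inv g \<otimes> x"]) (auto simp: m_assoc[symmetric])

lemma bij_betw_inv: "bij_betw (\<lambda>x. inv x) (carrier G) (carrier G)"
  by (rule bij_betwI[where g = "\<lambda>x. inv x"]) auto

lemma sum_mult_right:
  "g \<in> carrier G \<Longrightarrow> (\<Sum>x\<in>carrier G. h (x \<otimes> g)) = (\<Sum>x\<in>carrier G. h x)"
  by (rule sum.reindex_bij_betw[OF bij_betw_mult_right])

lemma sum_mult_left:
  "g \<in> carrier G \<Longrightarrow> (\<Sum>x\<in>carrier G. h (g \<otimes> x)) = (\<Sum>x\<in>carrier G. h x)"
  by (rule sum.reindex_bij_betw[OF bij_betw_mult_left])

lemma sum_inv: "(\<Sum>x\<in>carrier G. h (inv x)) = (\<Sum>x\<in>carrier G. h x)"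
  by (rule sum.reindex_bij_betw[OF bij_betw_inv])

lemma ip_trans: "g \<in> carrier G \<Longrightarrow> ip (carrier G) (trans g u) (trans g v) = ip (carrier G) u v"
  using sum_mult_right[of g "\<lambda>x. cnj (u x) * v x"] by (simp add: ip_def trans_def)

lemma nsq_trans: "g \<in> carrier G \<Longrightarrow> nsq (carrier G) (trans g u) = nsq (carrier G) u"
  using sum_mult_right[of g "\<lambda>x. (cmod (u x))\<^sup>2"] by (simp add: nsq_def trans_def)

lemma trans_trans:
  "g \<in> carrier G \<Longrightarrow> h \<in> carrier G \<Longrightarrow> trans g (trans h u) = trans (g \<otimes> h) u"
  by (auto simp: trans_def m_assoc)

lemma trans_one: "(\<And>x. x \<notin> carrier G \<Longrightarrow> u x = 0) \<Longrightarrow> trans \<one> u = u"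
  by (auto simp: trans_def)

lemma trans_sum: "trans g (\<lambda>x. \<Sum>i\<in>I. c i * v i x) = (\<lambda>x. \<Sum>i\<in>I. c i * trans g (v i) x)"
  by (auto simp: trans_def)

text \<open>The kernel \<open>k (z \<otimes> inv y)\<close> does not change when \<open>z\<close>
  and \<open>y\<close> are both multiplied by \<open>g\<close> on the right.\<close>

lemma conv_trans:
  assumes g: "g \<in> carrier G"
  shows "conv k (trans g v) = trans g (conv k v)"
proof
  fix z
  show "conv k (trans g v) z = trans g (conv k v) z"
  proof (cases "z \<in> carrier G")
    case z: True
    have "(\<Sum>y\<in>carrier G. k (z \<otimes> inv y) * trans g v y) =
        (\<Sum>y\<in>carrier G. k (z \<otimes> g \<otimes> inv (y \<otimes> g)) * v (y \<otimes> g))"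
    proof (rule sum.cong[OF refl])
      fix y assume y: "y \<in> carrier G"
      have "z \<otimes> g \<otimes> inv (y \<otimes> g) = z \<otimes> (g \<otimes> inv g) \<otimes> inv y"
        using g z y by (simp only: inv_mult_group m_assoc m_closed inv_closed)
      then show "k (z \<otimes> inv y) * trans g v y = k (z \<otimes> g \<otimes> inv (y \<otimes> g)) * v (y \<otimes> g)"
        using g z y by (simp add: trans_def)
    qed
    also have "\<dots> = (\<Sum>y\<in>carrier G. k (z \<otimes> g \<otimes> inv y) * v y)"
      by (rule sum_mult_right[OF g, of "\<lambda>y. k (z \<otimes> g \<otimes> inv y) * v y"])
    finally show ?thesis using g z by (simp add: conv_def trans_def)
  qed (simp add: conv_def trans_def)
qed

lemma conv_add: "conv k (\<lambda>x. u x + v x) = (\<lambda>x. conv k u x + conv k v x)"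
  by (auto simp: conv_def algebra_simps sum.distrib)

lemma conv_diff: "conv k (\<lambda>x. u x - v x) = (\<lambda>x. conv k u x - conv k v x)"
  by (auto simp: conv_def algebra_simps sum_subtractf)

lemma conv_scale: "conv k (\<lambda>x. c * v x) = (\<lambda>x. c * conv k v x)"
  by (auto simp: conv_def algebra_simps sum_distrib_left)

lemma conv_zero: "conv k (\<lambda>x. 0) = (\<lambda>x. 0)"
  by (auto simp: conv_def)

lemma conv_eq_ip:
  "z \<in> carrier G \<Longrightarrow> conv k v z = ip (carrier G) (\<lambda>y. cnj (k (z \<otimes> inv y))) v"
  by (simp add: conv_def ip_def)

text \<open>Each row of the kernel, conjugated to
  \<open>y \<mapsto> cnj (k (z \<otimes> inv y))\<close>, has squared norm
  \<open>nsq (carrier G) k\<close>. Bessel's inequality applies to every row, and there are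
  \<open>N\<close> of them.\<close>

lemma hilbert_schmidt_conv:
  assumes "orthonormal (carrier G) b m"
  shows "(\<Sum>i<m. nsq (carrier G) (conv k (b i))) \<le> N * nsq (carrier G) k"
proof -
  have "(\<Sum>i<m. nsq (carrier G) (conv k (b i))) =
      (\<Sum>z\<in>carrier G. \<Sum>i<m. (cmod (ip (carrier G) (b i) (\<lambda>y. cnj (k (z \<otimes> inv y)))))\<^sup>2)"
    unfolding nsq_def
    by (subst sum.swap, intro sum.cong refl, subst conv_eq_ip, assumption,
        subst cnj_ip[symmetric]) simp
  also have "\<dots> \<le> (\<Sum>z\<in>carrier G. nsq (carrier G) (\<lambda>y. cnj (k (z \<otimes> inv y))))"
    by (intro sum_mono bessel assms)
  also have "\<dots> = (\<Sum>z\<in>carrier G. nsq (carrier G) k)"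
  proof (rule sum.cong[OF refl])
    fix z assume z: "z \<in> carrier G"
    have "nsq (carrier G) (\<lambda>y. cnj (k (z \<otimes> inv y))) =
        (\<Sum>y\<in>carrier G. (cmod (k (z \<otimes> y)))\<^sup>2)"
      using sum_inv[of "\<lambda>y. (cmod (k (z \<otimes> y)))\<^sup>2"] by (simp add: nsq_def)
    also have "\<dots> = nsq (carrier G) k"
      using sum_mult_left[OF z, of "\<lambda>y. (cmod (k y))\<^sup>2"] by (simp add: nsq_def)
    finally show "nsq (carrier G) (\<lambda>y. cnj (k (z \<otimes> inv y))) = nsq (carrier G) k" .
  qed
  finally show ?thesis by simp
qed

text \<open>The operator norm is attained: in coordinates the unit sphere of \<open>W\<close> is
  compact and the squared norm of the image is continuous. Homogeneity carries the bound to all of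
  \<open>W\<close>.\<close>

lemma conv_max_on_subspace:
  assumes b: "onb (carrier G) b n W" and W: "fun_subspace (carrier G) W" and n: "n > 0"
  obtains v0 where "v0 \<in> W" "nsq (carrier G) v0 = 1"
    "\<And>v. v \<in> W \<Longrightarrow> nsq (carrier G) (conv k v) \<le> nsq (carrier G) (conv k v0) * nsq (carrier G) v"
proof -
  let ?X = "carrier G"
  define comb where "comb c = (\<lambda>x. \<Sum>i<n. c i * b i x)" for c :: "nat \<Rightarrow> complex"
  define S where "S = {c :: nat \<Rightarrow> complex. (\<forall>i\<ge>n. c i = 0) \<and> (\<Sum>i<n. (cmod (c i))\<^sup>2) = 1}"
  let ?F = "\<lambda>c. nsq ?X (conv k (comb c))"
  have ob: "orthonormal ?X b n" and bW: "\<And>i. i < n \<Longrightarrow> b i \<in> W"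
    using b by (auto simp: onb_def)
  have combW: "comb c \<in> W" for c
    unfolding comb_def using bW by (intro fun_subspace_sum[OF W]) auto
  have nsq_comb: "nsq ?X (comb c) = (\<Sum>i<n. (cmod (c i))\<^sup>2)" for c
    unfolding comb_def by (rule nsq_orthonormal_comb[OF ob])
  have cont: "continuous_on S (\<lambda>c :: nat \<Rightarrow> complex. c i)" for i
    by (rule continuous_on_subset[OF continuous_on_product_coordinates]) simp
  have "continuous_on S ?F"
    unfolding nsq_def conv_def comb_def
    by (simp cong: sum.cong) (intro continuous_intros cont)
  moreover have "compact S" unfolding S_def by (rule compact_coeff_sphere)
  moreover have "S \<noteq> {}"
  proof -
    have "(\<lambda>i. if i = 0 then 1 else 0) \<in> S"
      using n by (simp add: S_def if_distrib[of "\<lambda>z. (cmod z)\<^sup>2"] cong: if_cong)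
    then show ?thesis by blast
  qed
  ultimately obtain c0 where c0: "c0 \<in> S" "\<And>c. c \<in> S \<Longrightarrow> ?F c \<le> ?F c0"
    using continuous_attains_sup[of S ?F] by blast
  show ?thesis
  proof
    show "comb c0 \<in> W" by (rule combW)
    show "nsq ?X (comb c0) = 1" using c0(1) by (simp add: nsq_comb S_def)
    fix v assume v: "v \<in> W"
    show "nsq ?X (conv k v) \<le> ?F c0 * nsq ?X v"
    proof (cases "nsq ?X v = 0")
      case True
      then have "v = (\<lambda>x. 0)"
        using v W finite_carrier by (auto simp: nsq_eq_0 fun_subspace_def fun_eq_iff)
      then show ?thesis by (simp add: conv_zero nsq_def)
    next
      case False
      then have pos: "nsq ?X v > 0" using nsq_nonneg[of ?X v] by simp
      \<comment> \<open>Scaling by \<open>t\<close> moves \<open>v\<close> to the unit sphere, where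
        \<open>c0\<close> is maximal.\<close>
      define t where "t = complex_of_real (1 / sqrt (nsq ?X v))"
      define c where "c = (\<lambda>i. if i < n then t * ip ?X (b i) v else 0)"
      have t2: "(cmod t)\<^sup>2 = 1 / nsq ?X v"
        using pos by (simp add: t_def norm_divide power_divide)
      have "v = (\<lambda>x. \<Sum>i<n. ip ?X (b i) v * b i x)"
        using b v unfolding onb_def by blast
      from fun_cong[OF this] have "comb c = (\<lambda>x. t * v x)"
        by (auto simp: comb_def c_def sum_distrib_left mult.assoc fun_eq_iff)
      then have F: "?F c = nsq ?X (conv k v) / nsq ?X v"
        by (simp add: conv_scale nsq_scale t2)
      have "(\<Sum>i<n. (cmod (c i))\<^sup>2) = (\<Sum>i<n. (cmod t)\<^sup>2 * (cmod (ip ?X (b i) v))\<^sup>2)"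
        by (intro sum.cong) (auto simp: c_def norm_mult power_mult_distrib)
      also have "\<dots> = 1"
        using pos by (simp add: parseval[OF b v] t2 flip: sum_divide_distrib)
      finally have "c \<in> S" by (simp add: S_def c_def)
      from c0(2)[OF this] show ?thesis using pos by (simp add: F field_simps)
    qed
  qed
qed

text \<open>The vectors on which convolution by \<open>k\<close> attains its operator norm on \<open>W\<close> form a subspace, by
  the parallelogram law; it is invariant because convolution commutes with right translations.
  Its dimension is bounded through the Hilbert-Schmidt norm.\<close>

lemma conv_bound:
  assumes W: "invariant W"
    and dim: "\<And>E b p. invariant E \<Longrightarrow> E \<subseteq> W \<Longrightarrow> E \<noteq> {\<lambda>x. 0} \<Longrightarrow> onb (carrier G) b p E \<Longrightarrow> m \<le> p"
    and v: "v \<in> W"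
  shows "real m * nsq (carrier G) (conv k v) \<le> N * nsq (carrier G) k * nsq (carrier G) v"
proof -
  let ?X = "carrier G"
  have Ws: "fun_subspace ?X W" using W by (simp add: invariant_def)
  obtain b n where b: "onb ?X b n W" using exists_onb[OF finite_carrier Ws] .
  show ?thesis
  proof (cases "n = 0")
    case True
    have "v = (\<lambda>x. \<Sum>i<n. ip ?X (b i) v * b i x)"
      using b v unfolding onb_def by blast
    with True have "v = (\<lambda>x. 0)" by simp
    then show ?thesis by (simp add: conv_zero nsq_def)
  next
    case False
    then obtain v0 where v0: "v0 \<in> W" "nsq ?X v0 = 1"
      and max: "\<And>v. v \<in> W \<Longrightarrow> nsq ?X (conv k v) \<le> nsq ?X (conv k v0) * nsq ?X v"
      using conv_max_on_subspace[OF b Ws, of k] by blast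
    define l where "l = nsq ?X (conv k v0)"
    define E where "E = {w \<in> W. nsq ?X (conv k w) = l * nsq ?X w}"
    have add: "(\<lambda>x. u x + w x) \<in> E" if u: "u \<in> E" and w: "w \<in> E" for u w
    proof -
      have uw: "u \<in> W" "w \<in> W" and eq: "nsq ?X (conv k u) = l * nsq ?X u" "nsq ?X (conv k w) = l * nsq ?X w"
        using u w by (auto simp: E_def)
      have pW: "(\<lambda>x. u x + w x) \<in> W" using Ws uw unfolding fun_subspace_def by blast
      have mW: "(\<lambda>x. u x - w x) \<in> W" by (rule fun_subspace_diff[OF Ws uw])
      \<comment> \<open>The bounds \<open>max\<close> for the sum and for the difference add up to
        an equality, so neither of them is strict.\<close>
      have "nsq ?X (conv k (\<lambda>x. u x + w x)) + nsq ?X (conv k (\<lambda>x. u x - w x)) =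
          l * (2 * nsq ?X u + 2 * nsq ?X w)"
        unfolding conv_add conv_diff nsq_parallelogram eq by (simp add: algebra_simps)
      also have "\<dots> = l * nsq ?X (\<lambda>x. u x + w x) + l * nsq ?X (\<lambda>x. u x - w x)"
        unfolding nsq_parallelogram[symmetric] by (simp add: algebra_simps)
      finally have "nsq ?X (conv k (\<lambda>x. u x + w x)) = l * nsq ?X (\<lambda>x. u x + w x)"
        using max[OF pW] max[OF mW] by (simp add: l_def)
      with pW show ?thesis by (simp add: E_def)
    qed
    have E: "invariant E"
      unfolding invariant_def fun_subspace_def
    proof (intro conjI ballI allI impI)
      show "(\<lambda>x. 0) \<in> E" using Ws by (simp add: E_def conv_zero nsq_def fun_subspace_def)
      show "(\<lambda>x. c * u x) \<in> E" if "u \<in> E" for c u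
        using that Ws by (auto simp: E_def conv_scale nsq_scale fun_subspace_def)
      show "u x = 0" if "u \<in> E" "x \<notin> ?X" for u x
        using that Ws by (auto simp: E_def fun_subspace_def)
      show "trans g w \<in> E" if "g \<in> ?X" "w \<in> E" for g w
        using that W by (auto simp: E_def conv_trans nsq_trans invariant_def)
    qed (rule add)
    have "v0 \<in> E" using v0 by (simp add: E_def l_def)
    moreover have "v0 \<noteq> (\<lambda>x. 0)" using v0(2) by (auto simp: nsq_def)
    ultimately have E0: "E \<noteq> {\<lambda>x. 0}" by blast
    have EW: "E \<subseteq> W" by (auto simp: E_def)
    have "fun_subspace ?X E" using E by (simp add: invariant_def)
    then obtain e p where e: "onb ?X e p E" using exists_onb[OF finite_carrier] by blast
    have mp: "m \<le> p" by (rule dim[OF E EW E0 e])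
    have oe: "orthonormal ?X e p" using e by (simp add: onb_def)
    \<comment> \<open>Every one of the \<open>p\<close> basis vectors of \<open>E\<close> is
      stretched by the full factor \<open>l\<close>, so the Hilbert-Schmidt sum equals
      \<open>real p * l\<close>.\<close>
    have "nsq ?X (conv k (e i)) = l" if "i < p" for i
    proof -
      have "e i \<in> E" using e that by (simp add: onb_def)
      moreover have "nsq ?X (e i) = 1"
        using oe that ip_self[of ?X "e i"] by (simp add: orthonormal_def)
      ultimately show ?thesis by (simp add: E_def)
    qed
    then have "real p * l = (\<Sum>i<p. nsq ?X (conv k (e i)))" by simp
    also have "\<dots> \<le> N * nsq ?X k" by (rule hilbert_schmidt_conv[OF oe])
    finally have pl: "real p * l \<le> N * nsq ?X k" .
    have l0: "l \<ge> 0" by (simp add: l_def nsq_nonneg)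
    have "real m * nsq ?X (conv k v) \<le> real m * (l * nsq ?X v)"
      using max[OF v] by (intro mult_left_mono) (auto simp: l_def)
    also have "\<dots> \<le> real p * l * nsq ?X v"
      using mp l0 by (simp add: mult.assoc mult_right_mono nsq_nonneg)
    also have "\<dots> \<le> N * nsq ?X k * nsq ?X v"
      using pl by (intro mult_right_mono nsq_nonneg) simp
    finally show ?thesis .
  qed
qed

end

section \<open>Irreducible representations on spaces of functions\<close>

lemma subspace_vec_iff:
  "VectorSpace.subspace class_ring V (module_vec TYPE(complex) n) \<longleftrightarrow>
     V \<subseteq> carrier_vec n \<and> 0\<^sub>v n \<in> V \<and> (\<forall>u\<in>V. \<forall>v\<in>V. u + v \<in> V) \<and> (\<forall>c. \<forall>v\<in>V. c \<cdot>\<^sub>v v \<in> V)"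
proof -
  have vs: "vectorspace (class_ring :: complex ring) (module_vec TYPE(complex) n)"
    by (rule vec_vs)
  then have "Module.module (class_ring :: complex ring) (module_vec TYPE(complex) n)"
    by (simp add: vectorspace_def)
  with vs show ?thesis
    unfolding VectorSpace.subspace_def submodule_def module_vec_simps by auto
qed

section \<open>The general linear group and matrix representations\<close>

lemma group_GL: "group (GL n)"
proof -
  have "monoid (ring_mat TYPE(complex) n ())"
    using ring_mat[of n "()", where 'a = complex] by (rule ring.is_monoid)
  then show ?thesis unfolding GL_def by (rule monoid.units_group)
qed

lemma mult_GL: "mult (GL n) = (*)" and one_GL: "one (GL n) = 1\<^sub>m n"
  by (simp_all add: GL_def units_of_def ring_mat_simps)

lemma carrier_GL:
  "carrier (GL n) = {A \<in> carrier_mat n n. \<exists>B\<in>carrier_mat n n. B * A = 1\<^sub>m n \<and> A * B = 1\<^sub>m n}"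
  by (auto simp: GL_def units_of_def Units_def ring_mat_simps)

context finite_group
begin

lemma complex_repD:
  assumes "complex_rep G n \<rho>"
  shows "g \<in> carrier G \<Longrightarrow> \<rho> g \<in> carrier_mat n n"
    and "g \<in> carrier G \<Longrightarrow> h \<in> carrier G \<Longrightarrow> \<rho> (g \<otimes> h) = \<rho> g * \<rho> h"
    and "\<rho> \<one> = 1\<^sub>m n"
  using assms hom_one[OF _ group_axioms group_GL, of \<rho> n]
  by (auto simp: complex_rep_def hom_def carrier_GL mult_GL one_GL Pi_iff)

text \<open>Invertibility of \<open>\<rho> g\<close> follows from multiplicativity, with
  \<open>\<rho> (inv g)\<close> as the inverse.\<close>

lemma complex_repI:
  assumes "\<And>g. g \<in> carrier G \<Longrightarrow> \<rho> g \<in> carrier_mat n n"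
    and mult: "\<And>g h. g \<in> carrier G \<Longrightarrow> h \<in> carrier G \<Longrightarrow> \<rho> (g \<otimes> h) = \<rho> g * \<rho> h"
    and "\<rho> \<one> = 1\<^sub>m n"
  shows "complex_rep G n \<rho>"
proof -
  have "\<rho> (inv g) * \<rho> g = 1\<^sub>m n \<and> \<rho> g * \<rho> (inv g) = 1\<^sub>m n" if "g \<in> carrier G" for g
    using that assms(3) mult[of "inv g" g] mult[of g "inv g"] by simp
  then show ?thesis
    using assms(1) mult by (fastforce simp: complex_rep_def hom_def carrier_GL mult_GL)
qed

section \<open>Unitary matrices of right translation on an invariant space\<close>

definition rcoef :: "(nat \<Rightarrow> 'a \<Rightarrow> complex) \<Rightarrow> 'a \<Rightarrow> nat \<Rightarrow> nat \<Rightarrow> complex" where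
  "rcoef b g i j = ip (carrier G) (b i) (trans g (b j))"

text \<open>Irreducible subrepresentation of the right regular representation.\<close>

definition minimal_invariant :: "('a \<Rightarrow> complex) set \<Rightarrow> bool" where
  "minimal_invariant W \<longleftrightarrow> invariant W \<and> W \<noteq> {\<lambda>x. 0} \<and>
     (\<forall>E. invariant E \<and> E \<subseteq> W \<and> E \<noteq> {\<lambda>x. 0} \<longrightarrow> E = W)"

lemma trans_basis:
  assumes "invariant W" "onb (carrier G) b m W" "g \<in> carrier G" "j < m"
  shows "trans g (b j) = (\<lambda>x. \<Sum>i<m. rcoef b g i j * b i x)"
proof -
  have "trans g (b j) \<in> W" using assms by (simp add: invariant_def onb_def)
  from onb_expand[OF assms(2) this] show ?thesis by (simp only: rcoef_def)
qed

lemma rcoef_mult: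
  assumes "invariant W" "onb (carrier G) b m W" "g \<in> carrier G" "h \<in> carrier G" "j < m"
  shows "rcoef b (g \<otimes> h) i j = (\<Sum>k<m. rcoef b g i k * rcoef b h k j)"
proof -
  have "trans (g \<otimes> h) (b j) = trans g (trans h (b j))"
    using assms by (simp add: trans_trans)
  also have "\<dots> = (\<lambda>x. \<Sum>k<m. rcoef b h k j * trans g (b k) x)"
    by (subst trans_basis[OF assms(1,2,4,5)]) (rule trans_sum)
  finally have "trans (g \<otimes> h) (b j) = (\<lambda>x. \<Sum>k<m. rcoef b h k j * trans g (b k) x)" .
  then show ?thesis
    by (simp add: rcoef_def[of b "g \<otimes> h"] ip_sum) (simp add: rcoef_def mult.commute)
qed

lemma rcoef_one:
  assumes "invariant W" "onb (carrier G) b m W" "i < m" "j < m"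
  shows "rcoef b \<one> i j = (if i = j then 1 else 0)"
proof -
  have "trans \<one> (b j) = b j"
    using assms by (intro trans_one) (auto simp: invariant_def onb_def fun_subspace_def)
  then show ?thesis using assms by (simp add: rcoef_def onb_def orthonormal_def)
qed

text \<open>Right translation preserves \<open>ip\<close>, so in an orthonormal basis the inverse
  matrix is the conjugate transpose.\<close>

lemma rcoef_inv:
  assumes "invariant W" "onb (carrier G) b m W" "g \<in> carrier G" "i < m" "j < m"
  shows "rcoef b (inv g) i j = cnj (rcoef b g j i)"
proof -
  have "trans \<one> (b j) = b j"
    using assms by (intro trans_one) (auto simp: invariant_def onb_def fun_subspace_def)
  then have "trans g (trans (inv g) (b j)) = b j"
    using assms(3) by (simp add: trans_trans)
  then show ?thesis
    using ip_trans[OF assms(3), of "b i" "trans (inv g) (b j)"]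
    by (simp add: rcoef_def cnj_ip)
qed

text \<open>A diagonal entry of the matrix of \<open>g\<close> times that of \<open>inv g\<close> is
  1, and by unitarity it is the squared norm of a row.\<close>

lemma rcoef_frobenius:
  assumes "invariant W" "onb (carrier G) b m W" "g \<in> carrier G"
  shows "(\<Sum>i<m. \<Sum>j<m. (cmod (rcoef b g i j))\<^sup>2) = real m"
proof -
  have "(\<Sum>j<m. rcoef b g i j * rcoef b (inv g) j i) = 1" if "i < m" for i
    using rcoef_mult[OF assms(1,2,3) _ that, of "inv g" i] assms that rcoef_one[OF assms(1,2)]
    by simp
  then have "(\<Sum>j<m. complex_of_real ((cmod (rcoef b g i j))\<^sup>2)) = 1" if "i < m" for i
    using that assms by (simp add: complex_norm_square rcoef_inv del: of_real_power)
  then have "(\<Sum>i<m. \<Sum>j<m. complex_of_real ((cmod (rcoef b g i j))\<^sup>2)) = of_nat m"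
    by simp
  then have "complex_of_real (\<Sum>i<m. \<Sum>j<m. (cmod (rcoef b g i j))\<^sup>2) = of_real (real m)"
    by simp
  then show ?thesis by (simp only: of_real_eq_iff)
qed

text \<open>Coordinates identify column vectors with \<open>W\<close> and the matrix action with
  right translation. An invariant subspace of vectors becomes one of \<open>W\<close>, where
  minimality leaves only the two extreme cases.\<close>

lemma irreducible_rep_rcoef:
  assumes W: "minimal_invariant W" and b: "onb (carrier G) b m W"
  shows "irreducible_rep G m (\<lambda>g. mat m m (\<lambda>(i, j). rcoef b g i j))"
    (is "irreducible_rep G m ?\<rho>")
proof -
  let ?X = "carrier G"
  have inv: "invariant W" and W0: "W \<noteq> {\<lambda>x. 0}"
    and min: "\<And>E. invariant E \<Longrightarrow> E \<subseteq> W \<Longrightarrow> E \<noteq> {\<lambda>x. 0} \<Longrightarrow> E = W"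
    using W by (auto simp: minimal_invariant_def)
  have Ws: "fun_subspace ?X W" using inv by (simp add: invariant_def)
  have ob: "orthonormal ?X b m" and bW: "\<And>i. i < m \<Longrightarrow> b i \<in> W"
    using b by (auto simp: onb_def)
  have rep: "complex_rep G m ?\<rho>"
  proof (rule complex_repI)
    show "?\<rho> (g \<otimes> h) = ?\<rho> g * ?\<rho> h" if "g \<in> ?X" "h \<in> ?X" for g h
      using that by (intro eq_matI)
        (auto simp: rcoef_mult[OF inv b] scalar_prod_def atLeast0LessThan)
    show "?\<rho> \<one> = 1\<^sub>m m"
      by (intro eq_matI) (auto simp: rcoef_one[OF inv b])
  qed simp
  have "m \<noteq> 0"
  proof
    assume "m = 0"
    then have "w = (\<lambda>x. 0)" if "w \<in> W" for w using onb_expand[OF b that] by simp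
    moreover have "(\<lambda>x. 0) \<in> W" using Ws by (simp add: fun_subspace_def)
    ultimately show False using W0 by blast
  qed
  moreover have "V = {0\<^sub>v m} \<or> V = carrier_vec m"
    if V: "VectorSpace.subspace class_ring V (module_vec TYPE(complex) m)"
      and Vinv: "\<forall>g\<in>?X. \<forall>w\<in>V. ?\<rho> g *\<^sub>v w \<in> V" for V
  proof -
    have Vc: "V \<subseteq> carrier_vec m" and V0: "0\<^sub>v m \<in> V"
      and Vadd: "\<And>u v. u \<in> V \<Longrightarrow> v \<in> V \<Longrightarrow> u + v \<in> V" and Vsm: "\<And>c v. v \<in> V \<Longrightarrow> c \<cdot>\<^sub>v v \<in> V"
      using V by (auto simp: subspace_vec_iff)
    define comb where "comb v = (\<lambda>x. \<Sum>i<m. v $ i * b i x)" for v :: "complex vec"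
    have comb_coeff: "ip ?X (b i) (comb v) = v $ i" if "i < m" for i v
      unfolding comb_def by (rule ip_orthonormal_comb[OF ob that])
    have comb_inj: "u = v" if "u \<in> carrier_vec m" "v \<in> carrier_vec m" "comb u = comb v" for u v
      using that comb_coeff by (intro eq_vecI) (auto, metis)
    have comb0: "comb (0\<^sub>v m) = (\<lambda>x. 0)" by (simp add: comb_def)
    have combW: "comb v \<in> W" for v
      unfolding comb_def using bW by (intro fun_subspace_sum[OF Ws]) auto
    have comb_trans: "trans g (comb v) = comb (?\<rho> g *\<^sub>v v)"
      if g: "g \<in> ?X" and v: "v \<in> carrier_vec m" for g v
    proof
      fix x
      have "trans g (comb v) x = (\<Sum>j<m. v $ j * trans g (b j) x)"
        by (simp add: comb_def trans_sum)
      also have "\<dots> = (\<Sum>j<m. \<Sum>i<m. v $ j * (rcoef b g i j * b i x))"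
        by (simp add: trans_basis[OF inv b g] sum_distrib_left)
      also have "\<dots> = (\<Sum>i<m. (\<Sum>j<m. rcoef b g i j * v $ j) * b i x)"
        by (subst sum.swap) (simp add: sum_distrib_left sum_distrib_right mult_ac)
      also have "\<dots> = comb (?\<rho> g *\<^sub>v v) x"
        using v by (simp add: comb_def scalar_prod_def atLeast0LessThan)
      finally show "trans g (comb v) x = comb (?\<rho> g *\<^sub>v v) x" .
    qed
    define E where "E = comb ` V"
    have E: "invariant E"
      unfolding invariant_def fun_subspace_def
    proof (intro conjI ballI allI impI)
      show "(\<lambda>x. 0) \<in> E" using V0 comb0 by (force simp: E_def)
      show "(\<lambda>x. u x + v x) \<in> E" if uv: "u \<in> E" "v \<in> E" for u v
      proof -
        obtain u' v' where uv': "u' \<in> V" "v' \<in> V" "u = comb u'" "v = comb v'"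
          using uv by (auto simp: E_def)
        have "(\<lambda>x. u x + v x) = comb (u' + v')"
          using uv' Vc by (auto simp: comb_def algebra_simps sum.distrib fun_eq_iff)
        then show ?thesis using uv' Vadd by (auto simp: E_def)
      qed
      show "(\<lambda>x. c * u x) \<in> E" if u: "u \<in> E" for c u
      proof -
        obtain u' where u': "u' \<in> V" "u = comb u'"
          using u by (auto simp: E_def)
        have "(\<lambda>x. c * u x) = comb (c \<cdot>\<^sub>v u')"
          using u' Vc by (auto simp: comb_def algebra_simps sum_distrib_left fun_eq_iff)
        then show ?thesis using u' Vsm by (auto simp: E_def)
      qed
      show "u x = 0" if "u \<in> E" "x \<notin> ?X" for u x
        using that combW Ws by (auto simp: E_def fun_subspace_def)
      show "trans g w \<in> E" if "g \<in> ?X" "w \<in> E" for g w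
        using that Vinv Vc by (auto simp: E_def comb_trans)
    qed
    show ?thesis
    proof (cases "E = {\<lambda>x. 0}")
      case True
      then have "comb v = comb (0\<^sub>v m)" if "v \<in> V" for v
        using that comb0 by (auto simp: E_def)
      then have "v = 0\<^sub>v m" if "v \<in> V" for v
        using that Vc comb_inj[of v "0\<^sub>v m"] by auto
      with V0 show ?thesis by blast
    next
      case False
      have "E \<subseteq> W" using combW by (auto simp: E_def)
      with E False have "E = W" by (intro min)
      have "v \<in> V" if "v \<in> carrier_vec m" for v
      proof -
        have "comb v \<in> E" using combW \<open>E = W\<close> by simp
        then obtain v' where "v' \<in> V" "comb v = comb v'" by (auto simp: E_def)
        with that Vc comb_inj show ?thesis by blast
      qed
      with Vc show ?thesis by blast
    qed
  qed
  ultimately show ?thesis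
    using rep unfolding irreducible_rep_def by blast
qed

text \<open>In the trivial case the only basis vector is fixed by all translations, hence constant
  on the group; mean zero makes it vanish, against its norm 1.\<close>

lemma nontrivial_rep_rcoef:
  assumes W: "invariant W" and b: "onb (carrier G) b m W"
    and mean: "\<And>w. w \<in> W \<Longrightarrow> (\<Sum>x\<in>carrier G. w x) = 0"
  shows "\<not> trivial_rep G m (\<lambda>g. mat m m (\<lambda>(i, j). rcoef b g i j))"
proof
  let ?X = "carrier G"
  assume "trivial_rep G m (\<lambda>g. mat m m (\<lambda>(i, j). rcoef b g i j))"
  then have m: "m = 1" and tr: "\<And>g. g \<in> ?X \<Longrightarrow> mat 1 1 (\<lambda>(i, j). rcoef b g i j) = 1\<^sub>m 1"
    by (auto simp: trivial_rep_def)
  have "rcoef b g 0 0 = 1" if "g \<in> ?X" for g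
    using arg_cong[OF tr[OF that], of "\<lambda>A. A $$ (0, 0)"] by simp
  then have fixed: "trans g (b 0) = b 0" if "g \<in> ?X" for g
    using trans_basis[OF W b that, of 0] m that by simp
  have const: "b 0 g = b 0 \<one>" if "g \<in> ?X" for g
  proof -
    have "b 0 g = trans g (b 0) \<one>" using that by (simp add: trans_def)
    also have "\<dots> = b 0 \<one>" by (simp only: fixed[OF that])
    finally show ?thesis .
  qed
  have b0: "b 0 \<in> W" and nb: "nsq ?X (b 0) = 1"
    using b m orthonormal_nsq[of ?X b m 0] by (auto simp: onb_def)
  have "(\<Sum>x\<in>?X. b 0 x) = (\<Sum>x\<in>?X. b 0 \<one>)"
    by (intro sum.cong refl const)
  also have "\<dots> = of_nat (card ?X) * b 0 \<one>" by simp
  finally have "(\<Sum>x\<in>?X. b 0 x) = of_nat (card ?X) * b 0 \<one>" .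
  with mean[OF b0] N_pos have "b 0 \<one> = 0" by simp
  with const have "b 0 x = 0" if "x \<in> ?X" for x using that by metis
  with nb show False by (simp add: nsq_def)
qed

section \<open>Minimal invariant subspaces and the smallest nontrivial dimension\<close>

lemma exists_minimal_invariant:
  assumes W: "invariant W" "W \<noteq> {\<lambda>x. 0}" and b: "onb (carrier G) b p W"
  obtains E e q where "minimal_invariant E" "E \<subseteq> W" "onb (carrier G) e q E" "q \<le> p"
proof -
  let ?X = "carrier G"
  \<comment> \<open>Take a nonzero invariant subspace of \<open>W\<close> of least dimension: a
    nonzero invariant subspace inside it has at least that dimension, hence fills it.\<close>
  define P where "P q \<longleftrightarrow> (\<exists>E e. invariant E \<and> E \<subseteq> W \<and> E \<noteq> {\<lambda>x. 0} \<and> onb ?X e q E)" for q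
  have "P p" using W b by (auto simp: P_def)
  then have "P (Least P)" "Least P \<le> p" by (rule LeastI, rule Least_le)
  then obtain E e where E: "invariant E" "E \<subseteq> W" "E \<noteq> {\<lambda>x. 0}" "onb ?X e (Least P) E"
    by (auto simp: P_def)
  have "E' = E" if E': "invariant E'" "E' \<subseteq> E" "E' \<noteq> {\<lambda>x. 0}" for E'
  proof -
    have s: "fun_subspace ?X E'" "fun_subspace ?X E" using E' E by (auto simp: invariant_def)
    obtain e' q' where e': "onb ?X e' q' E'" using exists_onb[OF finite_carrier s(1)] .
    have "P q'" using E' E(2) e' unfolding P_def by blast
    then have "Least P \<le> q'" by (rule Least_le)
    with onb_subset_eq[OF finite_carrier s(2) E(4) E'(2) s(1) e'] show ?thesis .
  qed
  with E have "minimal_invariant E" by (auto simp: minimal_invariant_def)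
  with E \<open>Least P \<le> p\<close> that show ?thesis by blast
qed

text \<open>Pass to a minimal invariant subspace: its coefficients form an irreducible
  representation, and the mean-zero condition excludes the trivial one.\<close>

lemma nontrivial_irrep_in_mean_zero:
  assumes W: "invariant W" "W \<noteq> {\<lambda>x. 0}" and b: "onb (carrier G) b p W"
    and mean: "\<And>w. w \<in> W \<Longrightarrow> (\<Sum>x\<in>carrier G. w x) = 0"
  obtains q \<rho> where "(q, \<rho>) \<in> nontrivial_irreps G" "q \<le> p"
proof -
  obtain E e q where E: "minimal_invariant E" "E \<subseteq> W" "onb (carrier G) e q E" "q \<le> p"
    using exists_minimal_invariant[OF W b] .
  have "invariant E" using E(1) by (simp add: minimal_invariant_def)
  then have "\<not> trivial_rep G q (\<lambda>g. mat q q (\<lambda>(i, j). rcoef e g i j))"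
    using E(2) mean by (intro nontrivial_rep_rcoef[OF _ E(3)]) auto
  with irreducible_rep_rcoef[OF E(1,3)] E(4) that show ?thesis
    by (auto simp: nontrivial_irreps_def)
qed

lemma min_nontrivial_dim_le: "(q, \<rho>) \<in> nontrivial_irreps G \<Longrightarrow> min_nontrivial_dim G \<le> q"
  unfolding min_nontrivial_dim_def by (rule Least_le) blast

text \<open>The hypothesis makes the \<open>LEAST\<close> an attained value, and irreducibility
  includes positive dimension.\<close>

lemma min_nontrivial_dim_pos:
  assumes "(q, \<rho>) \<in> nontrivial_irreps G"
  shows "min_nontrivial_dim G > 0"
proof -
  have "\<exists>\<rho>. (min_nontrivial_dim G, \<rho>) \<in> nontrivial_irreps G"
    unfolding min_nontrivial_dim_def by (rule LeastI_ex) (use assms in blast)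
  then show ?thesis by (auto simp: nontrivial_irreps_def irreducible_rep_def)
qed

text \<open>Orthogonal complement of the constants, that is, the regular representation with its
  trivial constituent removed.\<close>

definition mean_zero :: "('a \<Rightarrow> complex) set" where
  "mean_zero = {u. (\<forall>x. x \<notin> carrier G \<longrightarrow> u x = 0) \<and> (\<Sum>x\<in>carrier G. u x) = 0}"

lemma sum_trans: "g \<in> carrier G \<Longrightarrow> (\<Sum>x\<in>carrier G. trans g w x) = (\<Sum>x\<in>carrier G. w x)"
  using sum_mult_right[of g w] by (simp add: trans_def)

lemma invariant_mean_zero: "invariant mean_zero"
proof -
  have "trans g w x = 0" if "x \<notin> carrier G" for g w x using that by (simp add: trans_def)
  then show ?thesis
    by (auto simp: invariant_def fun_subspace_def mean_zero_def sum.distrib sum_trans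
        simp flip: sum_distrib_left)
qed

lemma exists_nontrivial_irrep:
  assumes "carrier G \<noteq> {\<one>}"
  obtains q \<rho> where "(q, \<rho>) \<in> nontrivial_irreps G"
proof -
  obtain g where g: "g \<in> carrier G" "g \<noteq> \<one>" using assms one_closed by blast
  \<comment> \<open>The difference of the point masses at \<open>\<one>\<close> and \<open>g\<close>
    is a nonzero function of mean zero.\<close>
  define u where "u = (\<lambda>x. if x = \<one> then 1 else if x = g then -1 else 0 :: complex)"
  have "(\<Sum>x\<in>carrier G. u x) = (\<Sum>x\<in>{\<one>, g}. u x)"
    using g finite_carrier by (intro sum.mono_neutral_right) (auto simp: u_def)
  then have "u \<in> mean_zero" using g by (auto simp: mean_zero_def u_def)
  moreover have "u \<noteq> (\<lambda>x. 0)" by (auto simp: u_def fun_eq_iff)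
  ultimately have W0: "mean_zero \<noteq> {\<lambda>x. 0}" by blast
  have "fun_subspace (carrier G) mean_zero" using invariant_mean_zero by (simp add: invariant_def)
  then obtain b p where b: "onb (carrier G) b p mean_zero" using exists_onb[OF finite_carrier] by blast
  show ?thesis
    using nontrivial_irrep_in_mean_zero[OF invariant_mean_zero W0 b] that
    by (auto simp: mean_zero_def)
qed

text \<open>Quasirandomness of the group: a nonzero invariant subspace of \<open>mean_zero\<close>
  contains a nontrivial irreducible representation, so \<open>conv_bound\<close> applies with
  \<open>m\<close> equal to \<open>min_nontrivial_dim G\<close>.\<close>

lemma mixing:
  assumes v: "v \<in> mean_zero"
  shows "real (min_nontrivial_dim G) * nsq (carrier G) (conv u v)
    \<le> N * nsq (carrier G) u * nsq (carrier G) v"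
proof (rule conv_bound[OF invariant_mean_zero _ v])
  fix E b p assume E: "invariant E" "E \<subseteq> mean_zero" "E \<noteq> {\<lambda>x. 0}" "onb (carrier G) b p E"
  obtain q \<rho> where "(q, \<rho>) \<in> nontrivial_irreps G" "q \<le> p"
    using nontrivial_irrep_in_mean_zero[OF E(1,3,4)] E(2) by (auto simp: mean_zero_def)
  then show "min_nontrivial_dim G \<le> p" using min_nontrivial_dim_le by fastforce
qed

text \<open>The substitution \<open>z = x \<otimes> y\<close> turns the trilinear form into an inner
  product with a convolution, where \<open>mixing\<close> can be applied.\<close>

lemma ip_conv:
  "ip (carrier G) w (conv u v) = (\<Sum>x\<in>carrier G. \<Sum>y\<in>carrier G. u x * v y * cnj (w (x \<otimes> y)))"
proof -
  have "ip (carrier G) w (conv u v) =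
      (\<Sum>y\<in>carrier G. \<Sum>z\<in>carrier G. u (z \<otimes> inv y) * v y * cnj (w z))"
    unfolding ip_def conv_def by (subst sum.swap) (simp add: sum_distrib_left mult_ac)
  also have "\<dots> = (\<Sum>y\<in>carrier G. \<Sum>x\<in>carrier G. u x * v y * cnj (w (x \<otimes> y)))"
  proof (rule sum.cong[OF refl])
    fix y assume y: "y \<in> carrier G"
    have "(\<Sum>z\<in>carrier G. u (z \<otimes> inv y) * v y * cnj (w z)) =
        (\<Sum>x\<in>carrier G. u (x \<otimes> y \<otimes> inv y) * v y * cnj (w (x \<otimes> y)))"
      by (rule sum_mult_right[OF y, symmetric])
    also have "\<dots> = (\<Sum>x\<in>carrier G. u x * v y * cnj (w (x \<otimes> y)))"
      using y by (intro sum.cong) (auto simp: m_assoc)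
    finally show "(\<Sum>z\<in>carrier G. u (z \<otimes> inv y) * v y * cnj (w z)) = \<dots>" .
  qed
  also have "\<dots> = (\<Sum>x\<in>carrier G. \<Sum>y\<in>carrier G. u x * v y * cnj (w (x \<otimes> y)))"
    by (rule sum.swap)
  finally show ?thesis .
qed

text \<open>Schur orthogonality, as an inequality. With \<open>k g = cnj (v (inv g))\<close> the
  coefficient \<open>ip (carrier G) v (trans z w)\<close> is \<open>conv k w z\<close>. By
  minimality a nonzero invariant subspace of \<open>W\<close> is \<open>W\<close> itself, so
  \<open>conv_bound\<close> gives the factor \<open>n\<close>.\<close>

lemma minimal_invariant_schur:
  assumes W: "minimal_invariant W" and b: "onb (carrier G) b n W"
    and vw: "v \<in> W" "w \<in> W"
  shows "real n * (\<Sum>z\<in>carrier G. (cmod (ip (carrier G) v (trans z w)))\<^sup>2)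
    \<le> N * nsq (carrier G) v * nsq (carrier G) w"
proof -
  let ?X = "carrier G"
  define k where "k g = cnj (v (inv g))" for g
  have inv: "invariant W" using W by (simp add: minimal_invariant_def)
  have "n \<le> p" if E: "invariant E" "E \<subseteq> W" "E \<noteq> {\<lambda>x. 0}" and e: "onb ?X e p E" for E e p
  proof -
    have "E = W" using E W by (auto simp: minimal_invariant_def)
    with e b orthonormal_le_onb[of ?X b n W e p] show ?thesis by (auto simp: onb_def)
  qed
  then have *: "real n * nsq ?X (conv k w) \<le> N * nsq ?X k * nsq ?X w"
    by (intro conv_bound[OF inv _ vw(2)])
  have "nsq ?X k = nsq ?X v"
    unfolding nsq_def k_def using sum_inv[of "\<lambda>g. (cmod (v g))\<^sup>2"] by simp
  moreover have "conv k w z = ip ?X v (trans z w)" if z: "z \<in> ?X" for z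
  proof -
    have "conv k w z = (\<Sum>y\<in>?X. cnj (v (y \<otimes> inv z)) * w y)"
      using z by (simp add: conv_def k_def inv_mult_group)
    also have "\<dots> = (\<Sum>y\<in>?X. cnj (v (y \<otimes> z \<otimes> inv z)) * w (y \<otimes> z))"
      by (rule sum_mult_right[OF z, symmetric])
    also have "\<dots> = ip ?X v (trans z w)"
      unfolding ip_def trans_def using z by (intro sum.cong) (auto simp: m_assoc)
    finally show ?thesis .
  qed
  then have "nsq ?X (conv k w) = (\<Sum>z\<in>?X. (cmod (ip ?X v (trans z w)))\<^sup>2)"
    by (simp add: nsq_def)
  ultimately show ?thesis using * by simp
qed

section \<open>Realising an irreducible representation by functions on the group\<close>

lemma invariant_const: "invariant {u. \<exists>c. u = (\<lambda>x. if x \<in> carrier G then c else 0)}"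
  unfolding invariant_def fun_subspace_def
proof (intro conjI ballI allI impI)
  show "(\<lambda>x. 0) \<in> {u. \<exists>c. u = (\<lambda>x. if x \<in> carrier G then c else 0)}"
    by (auto intro!: exI[of _ 0])
qed (auto simp: trans_def fun_eq_iff)

text \<open>The rows \<open>x \<mapsto> \<rho> x $$ (0, j)\<close> of matrix coefficients span a copy of the representation inside
  the space of functions, on which right translation is unitary.\<close>

lemma irreducible_rep_function_model:
  assumes irr: "irreducible_rep G n \<rho>"
  obtains W b where "minimal_invariant W" "onb (carrier G) b n W"
    "\<not> trivial_rep G n \<rho> \<Longrightarrow> W \<subseteq> mean_zero"
proof -
  let ?X = "carrier G"
  have rep: "complex_rep G n \<rho>" and n: "n > 0"
    and sub: "\<And>V. VectorSpace.subspace class_ring V (module_vec TYPE(complex) n) \<Longrightarrow>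
      \<forall>g\<in>?X. \<forall>w\<in>V. \<rho> g *\<^sub>v w \<in> V \<Longrightarrow> V = {0\<^sub>v n} \<or> V = carrier_vec n"
    using irr by (auto simp: irreducible_rep_def)
  note \<rho>c = complex_repD(1)[OF rep] and \<rho>m = complex_repD(2)[OF rep] and \<rho>1 = complex_repD(3)[OF rep]
  define r where "r j = (\<lambda>x. if x \<in> ?X then \<rho> x $$ (0, j) else 0)" for j
  define \<Phi> where "\<Phi> v = (\<lambda>x. \<Sum>j<n. v $ j * r j x)" for v :: "complex vec"
  define W where "W = \<Phi> ` carrier_vec n"
  have \<Phi>_add: "\<Phi> (u + v) = (\<lambda>x. \<Phi> u x + \<Phi> v x)" if "u \<in> carrier_vec n" "v \<in> carrier_vec n" for u v
    using that by (auto simp: \<Phi>_def algebra_simps sum.distrib)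
  have \<Phi>_smult: "\<Phi> (c \<cdot>\<^sub>v v) = (\<lambda>x. c * \<Phi> v x)" if "v \<in> carrier_vec n" for c v
    using that by (auto simp: \<Phi>_def mult.assoc sum_distrib_left)
  have \<Phi>_zero: "\<Phi> (0\<^sub>v n) = (\<lambda>x. 0)"
    by (simp add: \<Phi>_def)
  have \<Phi>_unit: "\<Phi> (unit_vec n j) = r j" if "j < n" for j
  proof
    fix x
    have "\<Phi> (unit_vec n j) x = (\<Sum>i<n. if i = j then r i x else 0)"
      using that unfolding \<Phi>_def by (intro sum.cong) auto
    then show "\<Phi> (unit_vec n j) x = r j x" using that by simp
  qed
  have \<Phi>_trans: "trans g (\<Phi> v) = \<Phi> (\<rho> g *\<^sub>v v)" if g: "g \<in> ?X" and v: "v \<in> carrier_vec n" for g v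
  proof
    fix x
    show "trans g (\<Phi> v) x = \<Phi> (\<rho> g *\<^sub>v v) x"
    proof (cases "x \<in> ?X")
      case x: True
      note c = \<rho>c[OF g] \<rho>c[OF x]
      have "r j (x \<otimes> g) = (\<Sum>k<n. r k x * \<rho> g $$ (k, j))" if "j < n" for j
        using that x g c n by (simp add: r_def \<rho>m scalar_prod_def atLeast0LessThan)
      then have "trans g (\<Phi> v) x = (\<Sum>j<n. \<Sum>k<n. v $ j * (r k x * \<rho> g $$ (k, j)))"
        using x by (simp add: trans_def \<Phi>_def sum_distrib_left)
      also have "\<dots> = (\<Sum>k<n. (\<Sum>j<n. \<rho> g $$ (k, j) * v $ j) * r k x)"
        by (subst sum.swap) (simp add: sum_distrib_left sum_distrib_right mult_ac)
      also have "\<dots> = \<Phi> (\<rho> g *\<^sub>v v) x"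
        using v c by (simp add: \<Phi>_def scalar_prod_def atLeast0LessThan)
      finally show ?thesis .
    qed (simp add: trans_def \<Phi>_def r_def)
  qed
  \<comment> \<open>Irreducibility enters through preimages: \<open>\<Phi>\<close> intertwines the
    two actions, so an invariant \<open>E\<close> pulls back to an invariant subspace of column
    vectors.\<close>
  have preimage: "{v \<in> carrier_vec n. \<Phi> v \<in> E} = {0\<^sub>v n} \<or> {v \<in> carrier_vec n. \<Phi> v \<in> E} = carrier_vec n"
    if E: "invariant E" for E
  proof (rule sub)
    show "VectorSpace.subspace class_ring {v \<in> carrier_vec n. \<Phi> v \<in> E} (module_vec TYPE(complex) n)"
      using E by (auto simp: subspace_vec_iff invariant_def fun_subspace_def \<Phi>_add \<Phi>_smult \<Phi>_zero)
    show "\<forall>g\<in>?X. \<forall>w\<in>{v \<in> carrier_vec n. \<Phi> v \<in> E}. \<rho> g *\<^sub>v w \<in> {v \<in> carrier_vec n. \<Phi> v \<in> E}"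
      using E \<rho>c by (auto simp: invariant_def simp flip: \<Phi>_trans intro!: mult_mat_vec_carrier)
  qed
  have \<Phi>_ker: "v = 0\<^sub>v n" if v: "v \<in> carrier_vec n" "\<Phi> v = (\<lambda>x. 0)" for v
  proof -
    have inv0: "invariant {\<lambda>x. 0}" by (auto simp: invariant_def fun_subspace_def trans_def)
    \<comment> \<open>The kernel is not the whole space, because the identity matrix
      \<open>\<rho> \<one>\<close> has entry 1 at \<open>(0, 0)\<close>.\<close>
    have "\<Phi> (unit_vec n 0) \<one> = 1"
      using n by (simp add: \<Phi>_unit r_def \<rho>1)
    then have "\<Phi> (unit_vec n 0) \<noteq> (\<lambda>x. 0)" by auto
    moreover have "unit_vec n 0 \<in> (carrier_vec n :: complex vec set)" by simp
    ultimately have "{v \<in> carrier_vec n. \<Phi> v \<in> {\<lambda>x. 0}} = {0\<^sub>v n}"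
      using preimage[OF inv0] by blast
    with v show ?thesis by blast
  qed
  have \<Phi>_inj: "u = v" if uv: "u \<in> carrier_vec n" "v \<in> carrier_vec n" "\<Phi> u = \<Phi> v" for u v
  proof -
    have "\<Phi> (u + (-1) \<cdot>\<^sub>v v) = (\<lambda>x. 0)"
      using uv by (simp add: \<Phi>_add \<Phi>_smult)
    then have *: "u + (-1) \<cdot>\<^sub>v v = 0\<^sub>v n"
      using uv by (intro \<Phi>_ker) auto
    show ?thesis
    proof (rule eq_vecI)
      fix i assume "i < dim_vec v"
      then show "u $ i = v $ i"
        using arg_cong[OF *, of "\<lambda>w. w $ i"] uv by simp
    qed (use uv in auto)
  qed
  have W: "invariant W"
    unfolding invariant_def fun_subspace_def
  proof (intro conjI ballI allI impI)
    show "(\<lambda>x. 0) \<in> W"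
      using imageI[of "0\<^sub>v n" "carrier_vec n" \<Phi>] by (simp add: W_def \<Phi>_zero)
    show "(\<lambda>x. u x + v x) \<in> W" if "u \<in> W" "v \<in> W" for u v
      using that by (auto simp: W_def simp flip: \<Phi>_add)
    show "(\<lambda>x. c * u x) \<in> W" if "u \<in> W" for c u
      using that by (auto simp: W_def simp flip: \<Phi>_smult)
    show "u x = 0" if "u \<in> W" "x \<notin> ?X" for u x
      using that by (auto simp: W_def \<Phi>_def r_def)
    show "trans g w \<in> W" if "g \<in> ?X" "w \<in> W" for g w
      using that \<rho>c by (auto simp: W_def \<Phi>_trans intro!: imageI mult_mat_vec_carrier)
  qed
  have rW: "r j \<in> W" if "j < n" for j
    using that by (auto simp: W_def simp flip: \<Phi>_unit)
  have r_nz: "r j \<noteq> (\<lambda>x. 0)" if "j < n" for j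
  proof
    assume "r j = (\<lambda>x. 0)"
    then have "unit_vec n j = (0\<^sub>v n :: complex vec)"
      using that by (intro \<Phi>_ker) (auto simp: \<Phi>_unit)
    from arg_cong[OF this, of "\<lambda>w. w $ j"] that show False by simp
  qed
  have min: "minimal_invariant W"
    unfolding minimal_invariant_def
  proof (intro conjI allI impI)
    show "invariant W" by (rule W)
    show "W \<noteq> {\<lambda>x. 0}" using rW[OF n] r_nz[OF n] by blast
    fix E assume E: "invariant E \<and> E \<subseteq> W \<and> E \<noteq> {\<lambda>x. 0}"
    have "(\<lambda>x. 0) \<in> E" using E by (auto simp: invariant_def fun_subspace_def)
    with E obtain e where e: "e \<in> E" "e \<noteq> (\<lambda>x. 0)" by blast
    then obtain v where v: "v \<in> carrier_vec n" "e = \<Phi> v" using E by (auto simp: W_def)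
    with e \<Phi>_zero have "v \<noteq> 0\<^sub>v n" by auto
    with v e preimage[of E] E have "{v \<in> carrier_vec n. \<Phi> v \<in> E} = carrier_vec n" by blast
    then have "W \<subseteq> E" by (auto simp: W_def)
    with E show "E = W" by blast
  qed
  have Ws: "fun_subspace ?X W" using W by (simp add: invariant_def)
  obtain b m where b: "onb ?X b m W" using exists_onb[OF finite_carrier Ws] .
  \<comment> \<open>The basis \<open>b\<close> and the coefficient functions \<open>r\<close> are
    expressed through each other by \<open>V\<close> and \<open>?q\<close>. The sum of
    \<open>V i $ j * ?q i j\<close> is \<open>m\<close> taken by rows and \<open>n\<close> taken by
    columns.\<close>
  have "m = n"
  proof -
    have ob: "orthonormal ?X b m" and "\<forall>i<m. b i \<in> W" using b by (auto simp: onb_def)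
    then have "\<forall>i<m. \<exists>v. v \<in> carrier_vec n \<and> b i = \<Phi> v" by (auto simp: W_def)
    then obtain V where V: "\<And>i. i < m \<Longrightarrow> V i \<in> carrier_vec n" "\<And>i. i < m \<Longrightarrow> b i = \<Phi> (V i)"
      by metis
    let ?q = "\<lambda>i j. ip ?X (b i) (r j)"
    have rows: "(\<Sum>j<n. V i $ j * ?q i j) = 1" if i: "i < m" for i
    proof -
      have "(\<Sum>j<n. V i $ j * ?q i j) = ip ?X (b i) (\<Phi> (V i))"
        by (simp add: \<Phi>_def ip_sum)
      also have "\<dots> = 1" using ob i by (simp add: orthonormal_def flip: V(2))
      finally show ?thesis .
    qed
    have cols: "(\<Sum>i<m. V i $ j * ?q i j) = 1" if j: "j < n" for j
    proof -
      let ?v = "vec n (\<lambda>k. \<Sum>i<m. V i $ k * ?q i j)"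
      have "r j x = \<Phi> ?v x" for x
      proof -
        have "r j x = (\<Sum>i<m. ?q i j * b i x)"
          using fun_cong[OF onb_expand[OF b rW[OF j]], of x] .
        also have "\<dots> = (\<Sum>i<m. \<Sum>k<n. ?q i j * (V i $ k * r k x))"
          using V(2) by (simp add: \<Phi>_def sum_distrib_left)
        also have "\<dots> = \<Phi> ?v x"
          by (subst sum.swap) (simp add: \<Phi>_def sum_distrib_left sum_distrib_right mult_ac)
        finally show ?thesis .
      qed
      then have "unit_vec n j = ?v"
        using j by (intro \<Phi>_inj) (auto simp: \<Phi>_unit)
      from arg_cong[OF this, of "\<lambda>w. w $ j"] j show ?thesis by simp
    qed
    have "of_nat m = (\<Sum>i<m. \<Sum>j<n. V i $ j * ?q i j)" using rows by simp
    also have "\<dots> = (\<Sum>j<n. \<Sum>i<m. V i $ j * ?q i j)" by (rule sum.swap)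
    also have "\<dots> = (of_nat n :: complex)" using cols by simp
    finally show ?thesis by (simp only: of_nat_eq_iff)
  qed
  \<comment> \<open>The last claim is shown by contraposition. Summing all translates of a function
    in \<open>W\<close> with nonzero total gives a nonzero constant in \<open>W\<close>, and
    minimality makes \<open>W\<close> the space of constants.\<close>
  moreover have "trivial_rep G n \<rho>" if nmz: "\<not> W \<subseteq> mean_zero"
  proof -
    let ?C = "{u. \<exists>c. u = (\<lambda>x. if x \<in> ?X then c else (0 :: complex))}"
    obtain w where w: "w \<in> W" "(\<Sum>x\<in>?X. w x) \<noteq> 0"
      using nmz Ws by (auto simp: mean_zero_def fun_subspace_def)
    define s where "s = (\<lambda>x. \<Sum>g\<in>?X. 1 * trans g w x)"
    have "s \<in> W"
      unfolding s_def using W w by (intro fun_subspace_sum[OF Ws finite_carrier]) (auto simp: invariant_def)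
    moreover have s: "s = (\<lambda>x. if x \<in> ?X then \<Sum>g\<in>?X. w g else 0)"
      using sum_mult_left[of _ w] by (auto simp: s_def trans_def)
    have sC: "s \<in> ?C" unfolding s by blast
    have s0: "s \<noteq> (\<lambda>x. 0)" using w(2) one_closed by (auto simp: s fun_eq_iff)
    have CW: "u \<in> W" if uC: "u \<in> ?C" for u
    proof -
      obtain c where c: "u = (\<lambda>x. if x \<in> ?X then c else 0)" using uC by blast
      have "u = (\<lambda>x. (c / (\<Sum>g\<in>?X. w g)) * s x)" using w(2) by (auto simp: c s)
      with Ws \<open>s \<in> W\<close> show ?thesis unfolding fun_subspace_def by blast
    qed
    have "?C = W"
      using min invariant_const CW sC s0 unfolding minimal_invariant_def by blast
    then have const: "\<exists>c. \<Phi> v = (\<lambda>x. if x \<in> ?X then c else 0)" if "v \<in> carrier_vec n" for v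
      using that unfolding W_def by blast
    have "n = 1"
    proof (rule ccontr)
      assume "n \<noteq> 1"
      with n have n1: "1 < n" by simp
      obtain c where c: "r 1 = (\<lambda>x. if x \<in> ?X then c else 0)"
        using const[of "unit_vec n 1"] \<Phi>_unit[OF n1] by auto
      \<comment> \<open>The entry \<open>(0, 1)\<close> of the identity matrix is 0, so the constant
        function \<open>r 1\<close> would vanish, against \<open>r_nz\<close>.\<close>
      have "r 1 \<one> = 0" using n1 by (simp add: r_def \<rho>1)
      then have "c = 0" using fun_cong[OF c, of \<one>] by simp
      with c r_nz[OF n1] show False by auto
    qed
    moreover have "\<rho> g = 1\<^sub>m 1" if g: "g \<in> ?X" for g
    proof -
      obtain c where c: "r 0 = (\<lambda>x. if x \<in> ?X then c else 0)"
        using const[of "unit_vec n 0"] \<Phi>_unit[OF n] by auto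
      have "\<rho> g $$ (0, 0) = \<rho> \<one> $$ (0, 0)"
        using fun_cong[OF c, of g] fun_cong[OF c, of \<one>] g by (simp add: r_def)
      then show ?thesis
        using \<rho>c[OF g] \<open>n = 1\<close> by (intro eq_matI) (auto simp: \<rho>1)
    qed
    ultimately show ?thesis by (simp add: trivial_rep_def)
  qed
  ultimately show ?thesis using that min b by blast
qed

end

section \<open>The trilinear form\<close>

text \<open>\<open>S\<close> is the squared Frobenius norm of \<open>a\<close>, and the sum pairs
  the matrix square of \<open>a\<close> entrywise with \<open>a\<close>. Cauchy-Schwarz, once for
  the pairing and once for each entry of the square, gives the power 3/2 of
  \<open>S\<close>.\<close>

lemma trilinear_sum_le:
  fixes a :: "nat \<Rightarrow> nat \<Rightarrow> real" and d :: nat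
  defines "S \<equiv> \<Sum>i<d. \<Sum>j<d. (a i j)\<^sup>2"
  shows "(\<Sum>i<d. \<Sum>j<d. \<Sum>k<d. a i j * a j k * a i k) \<le> S * sqrt S"
proof -
  define c where "c i k = (\<Sum>j<d. a i j * a j k)" for i k
  have S0: "S \<ge> 0" unfolding S_def by (intro sum_nonneg) auto
  have "(\<Sum>i<d. \<Sum>j<d. \<Sum>k<d. a i j * a j k * a i k) = (\<Sum>i<d. \<Sum>k<d. c i k * a i k)"
    unfolding c_def sum_distrib_right by (intro sum.cong refl sum.swap)
  also have "\<dots> = (\<Sum>(i, k)\<in>{..<d} \<times> {..<d}. c i k * a i k)"
    by (simp add: sum.cartesian_product)
  finally have eq: "(\<Sum>i<d. \<Sum>j<d. \<Sum>k<d. a i j * a j k * a i k) =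
      (\<Sum>(i, k)\<in>{..<d} \<times> {..<d}. c i k * a i k)" .
  have "(\<Sum>(i, k)\<in>{..<d} \<times> {..<d}. c i k * a i k)\<^sup>2 \<le>
      (\<Sum>(i, k)\<in>{..<d} \<times> {..<d}. (c i k)\<^sup>2) * (\<Sum>(i, k)\<in>{..<d} \<times> {..<d}. (a i k)\<^sup>2)"
    using Cauchy_Schwarz_ineq_sum[of "\<lambda>p. c (fst p) (snd p)" "\<lambda>p. a (fst p) (snd p)" "{..<d} \<times> {..<d}"]
    by (simp add: case_prod_unfold)
  also have "(\<Sum>(i, k)\<in>{..<d} \<times> {..<d}. (a i k)\<^sup>2) = S"
    by (simp add: S_def sum.cartesian_product)
  also have "(\<Sum>(i, k)\<in>{..<d} \<times> {..<d}. (c i k)\<^sup>2) = (\<Sum>i<d. \<Sum>k<d. (c i k)\<^sup>2)"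
    by (simp add: sum.cartesian_product)
  also have "(\<Sum>i<d. \<Sum>k<d. (c i k)\<^sup>2) \<le> (\<Sum>i<d. \<Sum>k<d. (\<Sum>j<d. (a i j)\<^sup>2) * (\<Sum>j<d. (a j k)\<^sup>2))"
    unfolding c_def by (intro sum_mono Cauchy_Schwarz_ineq_sum)
  also have "\<dots> = S * (\<Sum>k<d. \<Sum>j<d. (a j k)\<^sup>2)"
    by (simp add: S_def sum_product)
  also have "(\<Sum>k<d. \<Sum>j<d. (a j k)\<^sup>2) = S"
    unfolding S_def by (rule sum.swap)
  finally have "(\<Sum>(i, k)\<in>{..<d} \<times> {..<d}. c i k * a i k)\<^sup>2 \<le> S * S * S"
    using S0 by (simp add: mult_right_mono)
  also have "\<dots> = (S * sqrt S)\<^sup>2"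
    using S0 by (simp add: power_mult_distrib power2_eq_square)
  finally have "(\<Sum>(i, k)\<in>{..<d} \<times> {..<d}. c i k * a i k) \<le> S * sqrt S"
    by (rule power2_le_imp_le) (use S0 in simp)
  with eq show ?thesis by simp
qed

text \<open>For fixed \<open>k\<close> the inner sum is the sesquilinear form of \<open>A\<close>
  with column \<open>k\<close> of \<open>A\<close> in both arguments; the squared column norms add
  up to the squared Frobenius norm.\<close>

lemma operator_norm_trilinear:
  fixes A :: "nat \<Rightarrow> nat \<Rightarrow> complex"
  assumes "\<And>c e. cmod (\<Sum>i<d. \<Sum>j<d. cnj (c i) * A i j * e j) \<le>
    K * sqrt (\<Sum>i<d. (cmod (c i))\<^sup>2) * sqrt (\<Sum>j<d. (cmod (e j))\<^sup>2)"
  shows "cmod (\<Sum>i<d. \<Sum>j<d. \<Sum>k<d. A i j * A j k * cnj (A i k)) \<le>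
    K * (\<Sum>i<d. \<Sum>j<d. (cmod (A i j))\<^sup>2)"
proof -
  have "(\<Sum>i<d. \<Sum>j<d. \<Sum>k<d. A i j * A j k * cnj (A i k)) =
      (\<Sum>i<d. \<Sum>k<d. \<Sum>j<d. A i j * A j k * cnj (A i k))"
    by (intro sum.cong refl sum.swap)
  also have "\<dots> = (\<Sum>i<d. \<Sum>k<d. \<Sum>j<d. cnj (A i k) * A i j * A j k)"
    by (simp only: mult_ac)
  also have "\<dots> = (\<Sum>k<d. \<Sum>i<d. \<Sum>j<d. cnj (A i k) * A i j * A j k)"
    by (rule sum.swap)
  finally have "cmod (\<Sum>i<d. \<Sum>j<d. \<Sum>k<d. A i j * A j k * cnj (A i k)) \<le>
      (\<Sum>k<d. cmod (\<Sum>i<d. \<Sum>j<d. cnj (A i k) * A i j * A j k))"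
    by (simp only:) (rule norm_sum)
  also have "\<dots> \<le> (\<Sum>k<d. K * sqrt (\<Sum>i<d. (cmod (A i k))\<^sup>2) * sqrt (\<Sum>i<d. (cmod (A i k))\<^sup>2))"
    by (intro sum_mono assms)
  also have "\<dots> = K * (\<Sum>k<d. \<Sum>i<d. (cmod (A i k))\<^sup>2)"
    by (simp add: mult.assoc sum_nonneg flip: sum_distrib_left)
  also have "(\<Sum>k<d. \<Sum>i<d. (cmod (A i k))\<^sup>2) = (\<Sum>i<d. \<Sum>j<d. (cmod (A i j))\<^sup>2)"
    by (rule sum.swap)
  finally show ?thesis .
qed

section \<open>Splitting a matrix-valued function into mean and mean-zero part\<close>

context finite_group
begin

lemma nsq_add_const:
  assumes "(\<Sum>x\<in>carrier G. u x) = 0"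
  shows "nsq (carrier G) (\<lambda>x. u x + a) = nsq (carrier G) u + N * (cmod a)\<^sup>2"
proof -
  have "(cmod (u x + a))\<^sup>2 = (cmod (u x))\<^sup>2 + (cmod a)\<^sup>2 + 2 * Re (cnj a * u x)" for x
    unfolding cmod_power2 by (simp add: power2_eq_square algebra_simps)
  moreover have "(\<Sum>x\<in>carrier G. Re (cnj a * u x)) = 0"
    unfolding Re_sum[symmetric] sum_distrib_left[symmetric] using assms by simp
  ultimately show ?thesis
    by (simp add: nsq_def sum.distrib flip: sum_distrib_left)
qed

text \<open>Any two of \<open>x\<close>, \<open>y\<close>, \<open>x \<otimes> y\<close> range
  independently over the group. A term with one or two mean-zero factors therefore contains a free
  sum that vanishes, and only the two extreme terms survive.\<close>

lemma trilinear_shift: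
  assumes u: "(\<Sum>x\<in>carrier G. u x) = 0" and v: "(\<Sum>x\<in>carrier G. v x) = 0"
    and w: "(\<Sum>x\<in>carrier G. w x) = 0"
  shows "(\<Sum>x\<in>carrier G. \<Sum>y\<in>carrier G. (u x + a) * (v y + b) * cnj (w (x \<otimes> y) + c)) =
    of_real (N\<^sup>2) * (a * b * cnj c) + (\<Sum>x\<in>carrier G. \<Sum>y\<in>carrier G. u x * v y * cnj (w (x \<otimes> y)))"
proof -
  let ?X = "carrier G"
  define T where "T x = (\<Sum>y\<in>?X. v y * cnj (w (x \<otimes> y)))" for x
  have wl: "(\<Sum>y\<in>?X. cnj (w (x \<otimes> y))) = 0" if "x \<in> ?X" for x
    using w sum_mult_left[OF that, of w] by (simp flip: cnj_sum)
  have wr: "(\<Sum>x\<in>?X. cnj (w (x \<otimes> y))) = 0" if "y \<in> ?X" for y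
    using w sum_mult_right[OF that, of w] by (simp flip: cnj_sum)
  have inner: "(\<Sum>y\<in>?X. (u x + a) * (v y + b) * cnj (w (x \<otimes> y) + c)) = (u x + a) * (T x + of_real N * (b * cnj c))"
    if "x \<in> ?X" for x
  proof -
    have "(\<Sum>y\<in>?X. (u x + a) * (v y + b) * cnj (w (x \<otimes> y) + c)) =
        (u x + a) * (\<Sum>y\<in>?X. v y * cnj (w (x \<otimes> y)) + cnj c * v y + b * cnj (w (x \<otimes> y)) + b * cnj c)"
      by (simp add: sum_distrib_left algebra_simps)
    also have "(\<Sum>y\<in>?X. v y * cnj (w (x \<otimes> y)) + cnj c * v y + b * cnj (w (x \<otimes> y)) + b * cnj c) =
        T x + of_real N * (b * cnj c)"
      using v wl[OF that] by (simp add: T_def sum.distrib flip: sum_distrib_left)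
    finally show ?thesis .
  qed
  have T0: "(\<Sum>x\<in>?X. T x) = 0"
    unfolding T_def by (subst sum.swap) (simp add: wr flip: sum_distrib_left)
  have "(\<Sum>x\<in>?X. \<Sum>y\<in>?X. (u x + a) * (v y + b) * cnj (w (x \<otimes> y) + c)) =
      (\<Sum>x\<in>?X. u x * T x + a * T x + (of_real N * (b * cnj c)) * u x + of_real N * (a * b * cnj c))"
    by (rule sum.cong[OF refl]) (subst inner, assumption, simp add: algebra_simps)
  also have "\<dots> = (\<Sum>x\<in>?X. u x * T x) + of_real N * (of_real N * (a * b * cnj c))"
    using u T0 by (simp add: sum.distrib flip: sum_distrib_left)
  also have "(\<Sum>x\<in>?X. u x * T x) = (\<Sum>x\<in>?X. \<Sum>y\<in>?X. u x * v y * cnj (w (x \<otimes> y)))"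
    by (simp add: T_def sum_distrib_left mult.assoc)
  finally show ?thesis by (simp add: power2_eq_square mult_ac)
qed

text \<open>Cauchy-Schwarz pairs \<open>w\<close> with \<open>conv u v\<close>, and
  \<open>mixing\<close> bounds the norm of the convolution.\<close>

lemma trilinear_mean_zero_bound:
  assumes D: "min_nontrivial_dim G > 0" and v: "v \<in> mean_zero"
  shows "cmod (\<Sum>x\<in>carrier G. \<Sum>y\<in>carrier G. u x * v y * cnj (w (x \<otimes> y))) \<le>
    sqrt (N / real (min_nontrivial_dim G)) *
      (sqrt (nsq (carrier G) u) * sqrt (nsq (carrier G) v) * sqrt (nsq (carrier G) w))"
proof -
  let ?X = "carrier G" and ?D = "real (min_nontrivial_dim G)"
  have "nsq ?X (conv u v) \<le> N / ?D * (nsq ?X u * nsq ?X v)"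
    using mixing[OF v, of u] D by (simp add: field_simps)
  then have "sqrt (nsq ?X (conv u v)) \<le> sqrt (N / ?D) * (sqrt (nsq ?X u) * sqrt (nsq ?X v))"
    by (simp flip: real_sqrt_mult)
  then have "sqrt (nsq ?X w) * sqrt (nsq ?X (conv u v)) \<le>
      sqrt (nsq ?X w) * (sqrt (N / ?D) * (sqrt (nsq ?X u) * sqrt (nsq ?X v)))"
    by (intro mult_left_mono) (simp_all add: nsq_nonneg)
  with cmod_ip_le[of ?X w "conv u v"] show ?thesis
    by (simp add: ip_conv mult_ac)
qed

text \<open>Pythagoras in each entry: the squared norm of the mean-zero part and \<open>N\<close>
  times that of the mean add up to \<open>N * real d\<close>, so each is at most that.\<close>

lemma average_frobenius_le:
  assumes d: "\<And>x. x \<in> carrier G \<Longrightarrow> (\<Sum>i<d. \<Sum>j<d. (cmod (F i j x))\<^sup>2) = real d"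
    and A: "\<And>i j. A i j = (\<Sum>x\<in>carrier G. F i j x) / of_real N"
  shows "(\<Sum>i<d. \<Sum>j<d. nsq (carrier G) (\<lambda>x. if x \<in> carrier G then F i j x - A i j else 0)) \<le> N * real d"
    and "(\<Sum>i<d. \<Sum>j<d. (cmod (A i j))\<^sup>2) \<le> real d"
    and "(\<lambda>x. if x \<in> carrier G then F i j x - A i j else 0) \<in> mean_zero"
proof -
  let ?X = "carrier G"
  let ?F = "\<lambda>i j x. if x \<in> ?X then F i j x - A i j else 0"
  have z: "(\<Sum>x\<in>?X. ?F i j x) = 0" for i j
    using N_pos by (simp add: A sum_subtractf)
  then show "?F i j \<in> mean_zero"
    by (simp add: mean_zero_def)
  have "nsq ?X (F i j) = nsq ?X (?F i j) + N * (cmod (A i j))\<^sup>2" for i j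
  proof -
    have "nsq ?X (F i j) = nsq ?X (\<lambda>x. ?F i j x + A i j)" by (simp add: nsq_def)
    then show ?thesis by (simp only: nsq_add_const[OF z])
  qed
  then have "(\<Sum>i<d. \<Sum>j<d. nsq ?X (F i j)) =
      (\<Sum>i<d. \<Sum>j<d. nsq ?X (?F i j)) + N * (\<Sum>i<d. \<Sum>j<d. (cmod (A i j))\<^sup>2)"
    by (simp add: sum.distrib sum_distrib_left)
  moreover have "(\<Sum>i<d. \<Sum>j<d. nsq ?X (F i j)) = (\<Sum>x\<in>?X. \<Sum>i<d. \<Sum>j<d. (cmod (F i j x))\<^sup>2)"
    unfolding nsq_def by (subst (2) sum.swap, subst sum.swap) simp
  moreover have "\<dots> = N * real d" using d by simp
  ultimately have eq: "(\<Sum>i<d. \<Sum>j<d. nsq ?X (?F i j)) + N * (\<Sum>i<d. \<Sum>j<d. (cmod (A i j))\<^sup>2) = N * real d"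
    by simp
  have "0 \<le> N * (\<Sum>i<d. \<Sum>j<d. (cmod (A i j))\<^sup>2)"
    by (intro mult_nonneg_nonneg sum_nonneg) auto
  with eq show "(\<Sum>i<d. \<Sum>j<d. nsq ?X (?F i j)) \<le> N * real d"
    by linarith
  have "0 \<le> (\<Sum>i<d. \<Sum>j<d. nsq ?X (?F i j))"
    by (intro sum_nonneg nsq_nonneg)
  with eq have "N * (\<Sum>i<d. \<Sum>j<d. (cmod (A i j))\<^sup>2) \<le> N * real d"
    by linarith
  then show "(\<Sum>i<d. \<Sum>j<d. (cmod (A i j))\<^sup>2) \<le> real d"
    using N_pos by (rule mult_left_le_imp_le)
qed

text \<open>The means contribute the cubic form in \<open>A\<close>. The mean-zero parts are bounded
  entry by entry with \<open>trilinear_mean_zero_bound\<close> and then summed with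
  \<open>trilinear_sum_le\<close>.\<close>

lemma trilinear_matrix_bound:
  assumes D: "min_nontrivial_dim G > 0"
    and d: "\<And>x. x \<in> carrier G \<Longrightarrow> (\<Sum>i<d. \<Sum>j<d. (cmod (F i j x))\<^sup>2) = real d"
    and A: "\<And>i j. A i j = (\<Sum>x\<in>carrier G. F i j x) / of_real N"
  shows "cmod (\<Sum>i<d. \<Sum>j<d. \<Sum>k<d. \<Sum>x\<in>carrier G. \<Sum>y\<in>carrier G. F i j x * F j k y * cnj (F i k (x \<otimes> y))) \<le>
    N\<^sup>2 * (cmod (\<Sum>i<d. \<Sum>j<d. \<Sum>k<d. A i j * A j k * cnj (A i k)) +
      real d * sqrt (real d / real (min_nontrivial_dim G)))"
proof -
  let ?X = "carrier G" and ?D = "real (min_nontrivial_dim G)"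
  define F0 where "F0 i j = (\<lambda>x. if x \<in> ?X then F i j x - A i j else 0)" for i j
  note avg = average_frobenius_le[where d = d and F = F and A = A, OF d A, folded F0_def]
  have z: "(\<Sum>x\<in>?X. F0 i j x) = 0" for i j
    using avg(3)[of i j] by (simp add: mean_zero_def)
  define t where "t i j k = (\<Sum>x\<in>?X. \<Sum>y\<in>?X. F0 i j x * F0 j k y * cnj (F0 i k (x \<otimes> y)))" for i j k
  define a where "a i j = sqrt (nsq ?X (F0 i j))" for i j
  have split: "(\<Sum>x\<in>?X. \<Sum>y\<in>?X. F i j x * F j k y * cnj (F i k (x \<otimes> y))) =
      of_real (N\<^sup>2) * (A i j * A j k * cnj (A i k)) + t i j k" for i j k
  proof -
    have "(\<Sum>x\<in>?X. \<Sum>y\<in>?X. F i j x * F j k y * cnj (F i k (x \<otimes> y))) =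
        (\<Sum>x\<in>?X. \<Sum>y\<in>?X. (F0 i j x + A i j) * (F0 j k y + A j k) * cnj (F0 i k (x \<otimes> y) + A i k))"
      by (intro sum.cong refl) (simp add: F0_def)
    then show ?thesis unfolding t_def by (simp only: trilinear_shift[OF z z z])
  qed
  have tle: "cmod (t i j k) \<le> sqrt (N / ?D) * (a i j * a j k * a i k)" for i j k
    unfolding t_def a_def by (rule trilinear_mean_zero_bound[OF D avg(3)])
  have "cmod (\<Sum>i<d. \<Sum>j<d. \<Sum>k<d. t i j k) \<le> (\<Sum>i<d. \<Sum>j<d. \<Sum>k<d. cmod (t i j k))"
    by (intro order_trans[OF norm_sum] sum_mono order_refl)
  also have "\<dots> \<le> (\<Sum>i<d. \<Sum>j<d. \<Sum>k<d. sqrt (N / ?D) * (a i j * a j k * a i k))"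
    by (intro sum_mono tle)
  also have "\<dots> = sqrt (N / ?D) * (\<Sum>i<d. \<Sum>j<d. \<Sum>k<d. a i j * a j k * a i k)"
    by (simp add: sum_distrib_left)
  also have "\<dots> \<le> sqrt (N / ?D) * (N * real d * sqrt (N * real d))"
  proof (rule mult_left_mono)
    let ?S = "\<Sum>i<d. \<Sum>j<d. (a i j)\<^sup>2"
    have S: "?S \<le> N * real d" using avg(1) by (simp add: a_def nsq_nonneg)
    have "(\<Sum>i<d. \<Sum>j<d. \<Sum>k<d. a i j * a j k * a i k) \<le> ?S * sqrt ?S"
      by (rule trilinear_sum_le)
    also have "\<dots> \<le> N * real d * sqrt (N * real d)"
      using S by (intro mult_mono real_sqrt_le_mono) (auto intro!: sum_nonneg)
    finally show "(\<Sum>i<d. \<Sum>j<d. \<Sum>k<d. a i j * a j k * a i k) \<le> N * real d * sqrt (N * real d)" .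
  qed simp
  \<comment> \<open>The square roots of \<open>N\<close> from the convolution bound and from the
    Frobenius norm combine with the factor \<open>N\<close> to its square.\<close>
  also have "\<dots> = N\<^sup>2 * (real d * sqrt (real d / ?D))"
    by (simp add: real_sqrt_mult real_sqrt_divide power2_eq_square mult_ac)
  finally have tbound: "cmod (\<Sum>i<d. \<Sum>j<d. \<Sum>k<d. t i j k) \<le> N\<^sup>2 * (real d * sqrt (real d / ?D))" .
  have "(\<Sum>i<d. \<Sum>j<d. \<Sum>k<d. \<Sum>x\<in>?X. \<Sum>y\<in>?X. F i j x * F j k y * cnj (F i k (x \<otimes> y))) =
      of_real (N\<^sup>2) * (\<Sum>i<d. \<Sum>j<d. \<Sum>k<d. A i j * A j k * cnj (A i k)) + (\<Sum>i<d. \<Sum>j<d. \<Sum>k<d. t i j k)"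
    unfolding split by (simp only: sum.distrib sum_distrib_left)
  then have "cmod (\<Sum>i<d. \<Sum>j<d. \<Sum>k<d. \<Sum>x\<in>?X. \<Sum>y\<in>?X. F i j x * F j k y * cnj (F i k (x \<otimes> y))) \<le>
      cmod (of_real (N\<^sup>2) * (\<Sum>i<d. \<Sum>j<d. \<Sum>k<d. A i j * A j k * cnj (A i k))) +
      cmod (\<Sum>i<d. \<Sum>j<d. \<Sum>k<d. t i j k)"
    by (simp only: norm_triangle_ineq)
  also have "cmod (of_real (N\<^sup>2) * (\<Sum>i<d. \<Sum>j<d. \<Sum>k<d. A i j * A j k * cnj (A i k))) =
      N\<^sup>2 * cmod (\<Sum>i<d. \<Sum>j<d. \<Sum>k<d. A i j * A j k * cnj (A i k))"
    by (simp only: norm_mult norm_of_real abs_power2)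
  finally show ?thesis using tbound by (simp add: distrib_left)
qed

text \<open>The form is the sum of \<open>q h * ip (carrier G) v (trans h w)\<close>, where
  \<open>v\<close> and \<open>w\<close> have coordinates \<open>c\<close> and \<open>e\<close>.
  Cauchy-Schwarz in \<open>h\<close> separates the weights, of squared norm at most
  \<open>\<epsilon> / N\<close>, from the coefficients, controlled by
  \<open>minimal_invariant_schur\<close>; then \<open>N\<close> cancels.\<close>

lemma weighted_average_operator_bound:
  fixes q :: "'a \<Rightarrow> real"
  assumes W: "minimal_invariant W" and b: "onb (carrier G) b n W" and n: "n > 0"
    and q: "(\<Sum>h\<in>carrier G. (q h)\<^sup>2) \<le> \<epsilon> / N"
    and A: "\<And>i j. A i j = (\<Sum>h\<in>carrier G. of_real (q h) * rcoef b h i j)"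
  shows "cmod (\<Sum>i<n. \<Sum>j<n. cnj (c i) * A i j * e j) \<le>
    sqrt (\<epsilon> / real n) * sqrt (\<Sum>i<n. (cmod (c i))\<^sup>2) * sqrt (\<Sum>j<n. (cmod (e j))\<^sup>2)"
proof -
  let ?X = "carrier G"
  have inv: "invariant W" using W by (simp add: minimal_invariant_def)
  then have Ws: "fun_subspace ?X W" by (simp add: invariant_def)
  have ob: "orthonormal ?X b n" and bW: "\<And>i. i < n \<Longrightarrow> b i \<in> W"
    using b by (auto simp: onb_def)
  define v where "v = (\<lambda>x. \<Sum>i<n. c i * b i x)"
  define w where "w = (\<lambda>x. \<Sum>j<n. e j * b j x)"
  have vw: "v \<in> W" "w \<in> W"
    unfolding v_def w_def using bW by (auto intro!: fun_subspace_sum[OF Ws])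
  have nv: "nsq ?X v = (\<Sum>i<n. (cmod (c i))\<^sup>2)" and nw: "nsq ?X w = (\<Sum>j<n. (cmod (e j))\<^sup>2)"
    unfolding v_def w_def by (rule nsq_orthonormal_comb[OF ob])+
  have ipvw: "ip ?X v (trans h w) = (\<Sum>i<n. \<Sum>j<n. cnj (c i) * rcoef b h i j * e j)" for h
  proof -
    have "ip ?X v (trans h w) = (\<Sum>j<n. e j * ip ?X v (trans h (b j)))"
      by (simp add: w_def trans_sum ip_sum)
    also have "\<dots> = (\<Sum>j<n. \<Sum>i<n. cnj (c i) * rcoef b h i j * e j)"
    proof (rule sum.cong[OF refl])
      fix j
      have "ip ?X v (trans h (b j)) = cnj (ip ?X (trans h (b j)) v)" by (simp add: cnj_ip)
      also have "\<dots> = (\<Sum>i<n. cnj (c i) * rcoef b h i j)"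
        by (simp add: v_def ip_sum cnj_ip rcoef_def)
      finally show "e j * ip ?X v (trans h (b j)) = (\<Sum>i<n. cnj (c i) * rcoef b h i j * e j)"
        by (simp add: sum_distrib_left mult_ac)
    qed
    also have "\<dots> = (\<Sum>i<n. \<Sum>j<n. cnj (c i) * rcoef b h i j * e j)" by (rule sum.swap)
    finally show ?thesis .
  qed
  let ?p = "\<lambda>h. cmod (ip ?X v (trans h w))"
  have "(\<Sum>i<n. \<Sum>j<n. cnj (c i) * A i j * e j) =
      (\<Sum>i<n. \<Sum>j<n. \<Sum>h\<in>?X. of_real (q h) * (cnj (c i) * rcoef b h i j * e j))"
    by (simp add: A sum_distrib_left sum_distrib_right mult_ac)
  also have "\<dots> = (\<Sum>i<n. \<Sum>h\<in>?X. \<Sum>j<n. of_real (q h) * (cnj (c i) * rcoef b h i j * e j))"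
    by (intro sum.cong refl sum.swap)
  also have "\<dots> = (\<Sum>h\<in>?X. \<Sum>i<n. \<Sum>j<n. of_real (q h) * (cnj (c i) * rcoef b h i j * e j))"
    by (rule sum.swap)
  also have "\<dots> = (\<Sum>h\<in>?X. of_real (q h) * ip ?X v (trans h w))"
    by (simp add: ipvw sum_distrib_left)
  finally have "cmod (\<Sum>i<n. \<Sum>j<n. cnj (c i) * A i j * e j) \<le> (\<Sum>h\<in>?X. \<bar>q h\<bar> * \<bar>?p h\<bar>)"
    by (simp only:) (rule order_trans[OF norm_sum], simp add: norm_mult)
  also have "\<dots> \<le> sqrt (\<Sum>h\<in>?X. (q h)\<^sup>2) * sqrt (\<Sum>h\<in>?X. (?p h)\<^sup>2)"
    using L2_set_mult_ineq[of q ?p ?X] by (simp add: L2_set_def)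
  also have "\<dots> \<le> sqrt (\<epsilon> / N) * sqrt (N * nsq ?X v * nsq ?X w / real n)"
  proof (intro mult_mono real_sqrt_le_mono q)
    show "(\<Sum>h\<in>?X. (?p h)\<^sup>2) \<le> N * nsq ?X v * nsq ?X w / real n"
      using minimal_invariant_schur[OF W b vw] n by (simp add: field_simps)
  next
    have "0 \<le> (\<Sum>h\<in>?X. (q h)\<^sup>2)" by (intro sum_nonneg) simp
    with q show "0 \<le> sqrt (\<epsilon> / N)" by simp
  qed (auto intro: sum_nonneg)
  also have "\<dots> = sqrt (\<epsilon> / real n) * sqrt (nsq ?X v) * sqrt (nsq ?X w)"
    using N_pos by (simp flip: real_sqrt_mult)
  finally show ?thesis by (simp only: nv nw)
qed

text \<open>For fixed \<open>x\<close> the element \<open>x \<otimes> h\<close> runs over the whole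
  group, so the inner sum is the total of \<open>b j\<close>. Hence the uniform distribution
  averages the matrices to 0.\<close>

lemma rcoef_sum_zero:
  assumes W: "invariant W" "W \<subseteq> mean_zero" and b: "onb (carrier G) b n W" and j: "j < n"
  shows "(\<Sum>h\<in>carrier G. rcoef b h i j) = 0"
proof -
  let ?X = "carrier G"
  have bj: "(\<Sum>x\<in>?X. b j x) = 0" using b j W(2) by (auto simp: onb_def mean_zero_def)
  have "(\<Sum>h\<in>?X. rcoef b h i j) = (\<Sum>x\<in>?X. cnj (b i x) * (\<Sum>h\<in>?X. b j (x \<otimes> h)))"
    unfolding rcoef_def ip_def by (subst sum.swap) (simp add: trans_def sum_distrib_left)
  also have "\<dots> = 0"
    using sum_mult_left[of _ "b j"] bj by simp
  finally show ?thesis .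
qed

text \<open>\<open>t\<close> is the Frobenius inner product of the matrices of
  \<open>g \<otimes> g'\<close> and \<open>h\<close>, both of squared norm \<open>n\<close>.
  Nonnegativity of the squared norm of their sum bounds the real part from below.\<close>

lemma rcoef_product_trace:
  assumes W: "invariant W" and b: "onb (carrier G) b n W"
    and g: "g \<in> carrier G" "g' \<in> carrier G" and h: "h \<in> carrier G"
  defines "t \<equiv> \<Sum>i<n. \<Sum>j<n. \<Sum>k<n. rcoef b g i j * rcoef b g' j k * cnj (rcoef b h i k)"
  shows "Re t \<ge> - real n" and "g \<otimes> g' = h \<Longrightarrow> Re t = real n"
proof -
  have "t = (\<Sum>i<n. \<Sum>k<n. \<Sum>j<n. rcoef b g i j * rcoef b g' j k * cnj (rcoef b h i k))"
    unfolding t_def by (intro sum.cong refl sum.swap)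
  also have "\<dots> = (\<Sum>i<n. \<Sum>k<n. rcoef b (g \<otimes> g') i k * cnj (rcoef b h i k))"
    by (simp add: rcoef_mult[OF W b g] sum_distrib_right)
  finally have t: "Re t = (\<Sum>i<n. \<Sum>k<n. Re (rcoef b (g \<otimes> g') i k * cnj (rcoef b h i k)))"
    by (simp add: Re_sum)
  note frob = rcoef_frobenius[OF W b]
  have "- ((cmod z)\<^sup>2 + (cmod w)\<^sup>2) / 2 \<le> Re (z * cnj w)" for z w
    using zero_le_power2[of "cmod (z + w)"]
    unfolding cmod_power2 by (simp add: power2_eq_square algebra_simps)
  then have "(\<Sum>i<n. \<Sum>k<n. - ((cmod (rcoef b (g \<otimes> g') i k))\<^sup>2 + (cmod (rcoef b h i k))\<^sup>2) / 2) \<le> Re t"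
    unfolding t by (intro sum_mono)
  also have "(\<Sum>i<n. \<Sum>k<n. - ((cmod (rcoef b (g \<otimes> g') i k))\<^sup>2 + (cmod (rcoef b h i k))\<^sup>2) / 2) = - real n"
    using frob[of "g \<otimes> g'"] frob[of h] g h
    by (simp add: sum_negf sum.distrib sum_subtractf flip: sum_divide_distrib)
  finally show "Re t \<ge> - real n" .
  assume "g \<otimes> g' = h"
  moreover have "Re (z * cnj z) = (cmod z)\<^sup>2" for z
    unfolding cmod_power2 by (simp add: power2_eq_square)
  ultimately show "Re t = real n" using frob[OF h] by (simp add: t)
qed

end

section \<open>Counting good pairs and passing to probabilities\<close>

lemma pair_pmf_of_set:
  assumes "finite A" "A \<noteq> {}" "finite B" "B \<noteq> {}"
  shows "pair_pmf (pmf_of_set A) (pmf_of_set B) = pmf_of_set (A \<times> B)"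
proof (rule pmf_eqI)
  fix z :: "'a \<times> 'b"
  show "pmf (pair_pmf (pmf_of_set A) (pmf_of_set B)) z = pmf (pmf_of_set (A \<times> B)) z"
    using assms by (cases z) (simp add: pmf_pair card_cartesian_product indicator_times)
qed

text \<open>The function model contains \<open>n\<close> orthonormal functions on the group. The
  bound makes the set of values in the final minimum finite.\<close>

lemma (in finite_group) irrep_dim_le_card:
  assumes "irreducible_rep G n \<rho>"
  shows "n \<le> card (carrier G)"
proof -
  obtain W b where "onb (carrier G) b n W"
    using irreducible_rep_function_model[OF assms] by blast
  then show ?thesis
    using orthonormal_card[OF finite_carrier] by (auto simp: onb_def)
qed

text \<open>The trilinear sum \<open>T\<close> of the matrix coefficients composed with
  \<open>f\<close> is bounded above by the mean and mean-zero estimates on \<open>G\<close>, and its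
  real part is bounded below by counting good pairs.\<close>

lemma homomorphism_count_bound:
  fixes G :: "('a, 'c) monoid_scheme" and H :: "('b, 'd) monoid_scheme" and f :: "'a \<Rightarrow> 'b"
  assumes G: "finite_group G" and H: "finite_group H" and f: "f \<in> carrier G \<rightarrow> carrier H"
    and D: "min_nontrivial_dim G > 0"
    and \<epsilon>: "(\<Sum>y\<in>carrier H. (real (card {x \<in> carrier G. f x = y}) / real (card (carrier G))
            - 1 / real (card (carrier H)))\<^sup>2) \<le> \<epsilon> / real (card (carrier H))"
    and irr: "(n, \<sigma>) \<in> nontrivial_irreps H"
  defines "good \<equiv> {p \<in> carrier G \<times> carrier G. f (fst p \<otimes>\<^bsub>G\<^esub> snd p) = f (fst p) \<otimes>\<^bsub>H\<^esub> f (snd p)}"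
  shows "2 * real (card good) \<le> (real (card (carrier G)))\<^sup>2 *
    (1 + sqrt (\<epsilon> / real n) + sqrt (real n / real (min_nontrivial_dim G)))"
proof -
  interpret G: finite_group G by (rule G)
  interpret H: finite_group H by (rule H)
  let ?X = "carrier G" and ?Y = "carrier H"
  have irr': "irreducible_rep H n \<sigma>" "\<not> trivial_rep H n \<sigma>" and n: "n > 0"
    using irr by (auto simp: nontrivial_irreps_def irreducible_rep_def)
  obtain W b where W: "H.minimal_invariant W" and b: "onb ?Y b n W" and mz: "W \<subseteq> H.mean_zero"
    using H.irreducible_rep_function_model[OF irr'(1)] irr'(2) by blast
  have inv: "H.invariant W" using W by (simp add: H.minimal_invariant_def)
  have fY: "f x \<in> ?Y" if "x \<in> ?X" for x using f that by blast
  define F where "F i j x = H.rcoef b (f x) i j" for i j x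
  define A where "A i j = (\<Sum>x\<in>?X. F i j x) / of_real G.N" for i j
  define p where "p y = real (card {x \<in> ?X. f x = y}) / G.N" for y
  have frob: "(\<Sum>i<n. \<Sum>j<n. (cmod (F i j x))\<^sup>2) = real n" if "x \<in> ?X" for x
    unfolding F_def by (rule H.rcoef_frobenius[OF inv b fY[OF that]])
  \<comment> \<open>Grouping \<open>x\<close> by the value \<open>f x\<close> turns the mean over
    \<open>G\<close> into a sum over \<open>H\<close> weighted by \<open>p\<close>. Subtracting the
    uniform weight changes nothing by \<open>rcoef_sum_zero\<close>, which requires
    \<open>j < n\<close>.\<close>
  have A_avg: "A i j = (\<Sum>y\<in>?Y. of_real (p y - 1 / H.N) * H.rcoef b y i j)" if j: "j < n" for i j
  proof -
    have "(\<Sum>x\<in>?X. F i j x) = (\<Sum>y\<in>?Y. \<Sum>x\<in>{x \<in> ?X. f x = y}. F i j x)"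
      using f G.finite_carrier H.finite_carrier by (intro sum.group[symmetric]) auto
    also have "\<dots> = (\<Sum>y\<in>?Y. of_nat (card {x \<in> ?X. f x = y}) * H.rcoef b y i j)"
      by (simp add: F_def)
    finally have "A i j = (\<Sum>y\<in>?Y. of_real (p y) * H.rcoef b y i j)"
      by (simp add: A_def p_def sum_divide_distrib)
    moreover have "(\<Sum>y\<in>?Y. of_real (1 / H.N) * H.rcoef b y i j) = 0"
      unfolding sum_distrib_left[symmetric] using H.rcoef_sum_zero[OF inv mz b j] by simp
    ultimately show ?thesis by (simp add: left_diff_distrib sum_subtractf)
  qed
  \<comment> \<open>\<open>A'\<close> satisfies the formula for all indices, as the operator bound
    demands, and agrees with \<open>A\<close> for \<open>j < n\<close>, the range of the
    sums.\<close>
  define A' where "A' i j = (\<Sum>y\<in>?Y. of_real (p y - 1 / H.N) * H.rcoef b y i j)" for i j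
  have "cmod (\<Sum>i<n. \<Sum>j<n. cnj (c i) * A i j * e j) \<le>
      sqrt (\<epsilon> / real n) * sqrt (\<Sum>i<n. (cmod (c i))\<^sup>2) * sqrt (\<Sum>j<n. (cmod (e j))\<^sup>2)" for c e
  proof -
    have "(\<Sum>i<n. \<Sum>j<n. cnj (c i) * A i j * e j) = (\<Sum>i<n. \<Sum>j<n. cnj (c i) * A' i j * e j)"
      by (intro sum.cong refl) (simp add: A_avg A'_def)
    also have "cmod \<dots> \<le>
        sqrt (\<epsilon> / real n) * sqrt (\<Sum>i<n. (cmod (c i))\<^sup>2) * sqrt (\<Sum>j<n. (cmod (e j))\<^sup>2)"
      by (rule H.weighted_average_operator_bound[OF W b n, where q = "\<lambda>y. p y - 1 / H.N"])
        (use \<epsilon> in \<open>simp_all only: p_def A'_def\<close>)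
    finally show ?thesis .
  qed
  then have "cmod (\<Sum>i<n. \<Sum>j<n. \<Sum>k<n. A i j * A j k * cnj (A i k)) \<le>
      sqrt (\<epsilon> / real n) * (\<Sum>i<n. \<Sum>j<n. (cmod (A i j))\<^sup>2)"
    by (rule operator_norm_trilinear)
  also have "\<dots> \<le> sqrt (\<epsilon> / real n) * real n"
  proof (rule mult_left_mono)
    show "(\<Sum>i<n. \<Sum>j<n. (cmod (A i j))\<^sup>2) \<le> real n"
      by (rule G.average_frobenius_le(2)[OF frob]) (simp_all only: A_def)
    \<comment> \<open>The hypothesis bounds a sum of squares by this quotient, which makes
      \<open>\<epsilon>\<close> nonnegative.\<close>
    have "0 \<le> \<epsilon> / H.N" by (rule order_trans[OF _ \<epsilon>]) (simp add: sum_nonneg)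
    then have "\<epsilon> \<ge> 0" using H.N_pos by (simp add: zero_le_divide_iff)
    then show "0 \<le> sqrt (\<epsilon> / real n)" by simp
  qed
  finally have AAA: "cmod (\<Sum>i<n. \<Sum>j<n. \<Sum>k<n. A i j * A j k * cnj (A i k)) \<le> real n * sqrt (\<epsilon> / real n)"
    by (simp add: mult.commute)
  define T where "T = (\<Sum>i<n. \<Sum>j<n. \<Sum>k<n. \<Sum>x\<in>?X. \<Sum>y\<in>?X. F i j x * F j k y * cnj (F i k (x \<otimes>\<^bsub>G\<^esub> y)))"
  define t where "t z = (\<Sum>i<n. \<Sum>j<n. \<Sum>k<n. F i j (fst z) * F j k (snd z) * cnj (F i k (fst z \<otimes>\<^bsub>G\<^esub> snd z)))" for z
  have "cmod T \<le> G.N\<^sup>2 * (cmod (\<Sum>i<n. \<Sum>j<n. \<Sum>k<n. A i j * A j k * cnj (A i k)) +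
      real n * sqrt (real n / real (min_nontrivial_dim G)))"
    unfolding T_def by (rule G.trilinear_matrix_bound[OF D frob]) (simp_all only: A_def)
  also have "\<dots> \<le> G.N\<^sup>2 * (real n * sqrt (\<epsilon> / real n) + real n * sqrt (real n / real (min_nontrivial_dim G)))"
    using AAA by (intro mult_left_mono add_right_mono) auto
  finally have upper: "cmod T \<le> \<dots>" .
  have "T = (\<Sum>i<n. \<Sum>j<n. \<Sum>k<n. \<Sum>z\<in>?X \<times> ?X. F i j (fst z) * F j k (snd z) * cnj (F i k (fst z \<otimes>\<^bsub>G\<^esub> snd z)))"
    unfolding T_def by (simp add: sum.cartesian_product case_prod_unfold)
  also have "\<dots> = (\<Sum>i<n. \<Sum>j<n. \<Sum>z\<in>?X \<times> ?X. \<Sum>k<n. F i j (fst z) * F j k (snd z) * cnj (F i k (fst z \<otimes>\<^bsub>G\<^esub> snd z)))"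
    by (intro sum.cong refl sum.swap)
  also have "\<dots> = (\<Sum>i<n. \<Sum>z\<in>?X \<times> ?X. \<Sum>j<n. \<Sum>k<n. F i j (fst z) * F j k (snd z) * cnj (F i k (fst z \<otimes>\<^bsub>G\<^esub> snd z)))"
    by (intro sum.cong refl sum.swap)
  also have "\<dots> = (\<Sum>z\<in>?X \<times> ?X. t z)"
    unfolding t_def by (rule sum.swap)
  finally have Tt: "Re T = (\<Sum>z\<in>?X \<times> ?X. Re (t z))" by (simp add: Re_sum)
  have fin: "finite (?X \<times> ?X)" using G.finite_carrier by simp
  \<comment> \<open>The summand is \<open>n\<close> on good pairs and \<open>-n\<close> on all
    others, matching the two cases of \<open>rcoef_product_trace\<close>.\<close>
  have "real n * (2 * real (card good) - G.N\<^sup>2) = (\<Sum>z\<in>?X \<times> ?X. 2 * real n * indicator good z - real n)"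
  proof -
    have "(\<Sum>z\<in>?X \<times> ?X. indicator good z) = real (card good)"
    proof -
      have "?X \<times> ?X \<inter> good = good" by (auto simp: good_def)
      then show ?thesis
        using sum.inter_restrict[OF fin, of "\<lambda>_. 1 :: real" good] by (simp add: indicator_def of_bool_def)
    qed
    then show ?thesis
      by (simp add: sum_subtractf card_cartesian_product power2_eq_square algebra_simps
          flip: sum_distrib_left sum_distrib_right)
  qed
  also have "\<dots> \<le> (\<Sum>z\<in>?X \<times> ?X. Re (t z))"
  proof (rule sum_mono)
    fix z assume z: "z \<in> ?X \<times> ?X"
    then have Y: "f (fst z) \<in> ?Y" "f (snd z) \<in> ?Y" "f (fst z \<otimes>\<^bsub>G\<^esub> snd z) \<in> ?Y"
      using fY by auto
    show "2 * real n * indicator good z - real n \<le> Re (t z)"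
      using H.rcoef_product_trace[OF inv b Y] z
      by (auto simp: t_def F_def good_def indicator_def)
  qed
  also have "\<dots> \<le> cmod T" unfolding Tt[symmetric] by (rule complex_Re_le_cmod)
  also note upper
  also have "G.N\<^sup>2 * (real n * sqrt (\<epsilon> / real n) + real n * sqrt (real n / real (min_nontrivial_dim G))) =
      real n * (G.N\<^sup>2 * (sqrt (\<epsilon> / real n) + sqrt (real n / real (min_nontrivial_dim G))))"
    by (simp add: algebra_simps)
  finally have "2 * real (card good) - G.N\<^sup>2 \<le>
      G.N\<^sup>2 * (sqrt (\<epsilon> / real n) + sqrt (real n / real (min_nontrivial_dim G)))"
    using n by (simp only: mult_le_cancel_left_pos of_nat_0_less_iff)
  then show ?thesis by (simp add: algebra_simps)
qed

theorem theorem2: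
  fixes G :: "('a, 'c) monoid_scheme" and H :: "('b, 'd) monoid_scheme"
    and f :: "'a \<Rightarrow> 'b" and \<epsilon> :: real
  assumes "group G" and "finite (carrier G)" and "carrier G \<noteq> {\<one>\<^bsub>G\<^esub>}"
    and "group H" and "finite (carrier H)" and "carrier H \<noteq> {\<one>\<^bsub>H\<^esub>}"
    and "\<epsilon> \<ge> 0"
    and "f \<in> carrier G \<rightarrow> carrier H"
    and "(\<Sum>y\<in>carrier H. \<bar>pmf (map_pmf f (pmf_of_set (carrier G))) y
            - 1 / real (card (carrier H))\<bar>\<^sup>2) \<le> \<epsilon> / real (card (carrier H))"
  shows "measure_pmf.prob (pair_pmf (pmf_of_set (carrier G)) (pmf_of_set (carrier G)))
           {(x, y). f (x \<otimes>\<^bsub>G\<^esub> y) = f x \<otimes>\<^bsub>H\<^esub> f y}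
         \<le> 1 / 2 * (MIN (d, \<sigma>) \<in> nontrivial_irreps H.
              1 + sqrt (\<epsilon> / real d) + sqrt (real d / real (min_nontrivial_dim G)))"
proof -
  interpret G: finite_group G
    using assms(1,2) by (simp add: finite_group_def finite_group_axioms_def)
  interpret H: finite_group H
    using assms(4,5) by (simp add: finite_group_def finite_group_axioms_def)
  let ?X = "carrier G" and ?Y = "carrier H"
  let ?b = "\<lambda>d. 1 + sqrt (\<epsilon> / real d) + sqrt (real d / real (min_nontrivial_dim G))"
  let ?S = "(\<lambda>(d, \<sigma>). ?b d) ` nontrivial_irreps H"
  define good where "good = {p \<in> ?X \<times> ?X. f (fst p \<otimes>\<^bsub>G\<^esub> snd p) = f (fst p) \<otimes>\<^bsub>H\<^esub> f (snd p)}"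
  have ne: "?X \<noteq> {}" using G.one_closed by blast
  have D: "min_nontrivial_dim G > 0"
    using G.exists_nontrivial_irrep[OF assms(3)] G.min_nontrivial_dim_pos by blast
  have pmf: "pmf (map_pmf f (pmf_of_set ?X)) y = real (card {x \<in> ?X. f x = y}) / G.N" for y
    using ne assms(2) by (simp add: pmf_map measure_pmf_of_set Int_def vimage_def)
  have \<epsilon>: "(\<Sum>y\<in>?Y. (real (card {x \<in> ?X. f x = y}) / G.N - 1 / H.N)\<^sup>2) \<le> \<epsilon> / H.N"
    using assms(9) by (simp only: pmf power2_abs)
  \<comment> \<open>The value attached to a representation depends only on its dimension, which is
    at most the order of \<open>H\<close>; so finitely many values occur and the minimum is
    attained.\<close>
  have "?S \<subseteq> ?b ` {..card ?Y}"
    using H.irrep_dim_le_card by (fastforce simp: nontrivial_irreps_def)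
  then have "finite ?S" by (rule finite_subset) simp
  moreover have "?S \<noteq> {}" using H.exists_nontrivial_irrep[OF assms(6)] by blast
  ultimately have "Min ?S \<in> ?S" by (rule Min_in)
  then obtain n \<sigma> where n: "(n, \<sigma>) \<in> nontrivial_irreps H" "Min ?S = ?b n" by auto
  \<comment> \<open>The event itself is not restricted to the carrier; its intersection with the
    support of the distribution is \<open>good\<close>.\<close>
  have "?X \<times> ?X \<inter> {(x, y). f (x \<otimes>\<^bsub>G\<^esub> y) = f x \<otimes>\<^bsub>H\<^esub> f y} = good"
    by (auto simp: good_def)
  then have "measure_pmf.prob (pair_pmf (pmf_of_set ?X) (pmf_of_set ?X))
      {(x, y). f (x \<otimes>\<^bsub>G\<^esub> y) = f x \<otimes>\<^bsub>H\<^esub> f y} = real (card good) / G.N\<^sup>2"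
    using ne assms(2)
    by (simp add: pair_pmf_of_set measure_pmf_of_set card_cartesian_product power2_eq_square)
  also have "\<dots> \<le> 1 / 2 * ?b n"
    using homomorphism_count_bound[OF G.finite_group_axioms H.finite_group_axioms assms(8) D \<epsilon> n(1)]
      G.N_pos by (simp add: good_def field_simps)
  finally show ?thesis by (simp only: n(2))
qed

end
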